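(* Let $r,s>0$ be integers with $\gcd(r,s)=1$, and let $\lambda_{r,s}$ be the Young diagram of the boxes lying above the diagonal of the $s\times r$ rectangle. In type $A$, for every $m\ge1$, $$\mathfrak H^{daha}_{r,s}[m](q,t,\mathsf a)=\mathcal H^{daha}_{r,s}(q,t,\mathsf a;\omega_m),$$ where $\mathfrak H^{daha}_{r,s}[m]=\mathfrak H^{daha}_{\lambda_{r,s}}[m]$ is the superpolynomial attached to the Young diagram $\lambda_{r,s}$, and $\mathcal H^{daha}_{r,s}(q,t,\mathsf a;\omega_m)$ is the DAHA superpolynomial of the torus knot $T(r,s)$ colored by $\omega_m$. For any reduced irreducible root system $R$ and any minuscule weight $\omega_m$ of $R$, $$\hat{\mathfrak J}^{daha}_{r,s}[m]=\hat{\mathcal J}^{daha}_{r,s}(\omega_m),$$ i.e. the hat-normalizations of $\{W_{\lambda_{r,s}}[m]\,X_m\}$ and of the DAHA-Jones polynomial of $T(r,s)$ for $R$ colored by $\omega_m$ coincide.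
   Context: DAHA operators. Let $R$ be a reduced irreducible root system of rank $n$ with simple roots $\alpha_i$, Weyl group $W$, longest element $w_0$, fundamental weights $\omega_i$ ($(\omega_i,\alpha_j^\vee)=\delta_{ij}$), weight lattice $P=\oplus\mathbb Z\omega_i$; the inner product is normalized by $(\alpha,\alpha)=2$ for short roots, and $\nu_\alpha=(\alpha,\alpha)/2$. The parameters are $q$ and $t_\nu$ (one for each root length; a single $t$ in the simply-laced case), with rational powers allowed; $t_i=t_{\nu_{\alpha_i}}$; $\rho_\nu=\frac12\sum_{\alpha>0,\nu_\alpha=\nu}\alpha$. On the ring of Laurent polynomials spanned by $X_b$ ($b\in P$, $X_bX_c=X_{b+c}$), $W$ acts by $w(X_b)=X_{w(b)}$, and $$T_i=t_i^{1/2}s_i+\frac{t_i^{1/2}-t_i^{-1/2}}{X_{\alpha_i}-1}(s_i-1)\quad(1\le i\le n),$$ $T_w=T_{i_1}\cdots T_{i_l}$ for reduced $w=s_{i_1}\cdots s_{i_l}$. A weight $\omega_m$ is minuscule if $0\le(\omega_m,\alpha^\vee)\le1$ for all $\alpha>0$ (all $\omega_m$ in type $A$). For minuscule $\omega_m$ let $u_m\in W$ be the element of minimal length with $u_m(\omega_m)=w_0(\omega_m)$, let $\pi_m(X_b)=q^{-(w_0(\omega_m),b)}X_{u_m^{-1}(b)}$, and let $Y_m=Y_{\omega_m}=\pi_mT_{u_m}$, $X_m=$ multiplication by $X_{\omega_m}$. These operators generate (part of) the double affine Hecke algebra acting in its polynomial representation. The coinvariant is $\{H\}=H(1)\big|_{X_b\mapsto\prod_\nu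 t_\nu^{-(\rho_\nu,b)/\nu}}$ (i.e. $X_b\mapsto t^{-(\rho,b)}$ when there is a single $t$). Hat-normalization. Coinvariants are considered up to monomial factors $q^{\bullet}t_\nu^{\bullet}$ with rational exponents. The hat-normalization of such an expression is the proportional polynomial in $q,t$ with integer coefficients, not divisible by $q$ or $t$, with the greatest common divisor of all coefficients equal to $1$, and with positive coefficient of the minimal pure power of $t$. Words of Young diagrams. For $\lambda=(\lambda_1\ge\cdots\ge\lambda_\ell>0)$ put $W_\lambda=Y X^{\lambda_1-\lambda_2}\,Y X^{\lambda_2-\lambda_3}\cdots Y X^{\lambda_\ell}$ (reading the border from top to bottom), and let $W_\lambda[m]$ be the result of the substitution $X\mapsto X_m$, $Y\mapsto Y_m$. Put $\mathfrak J_\lambda[m]=\{W_\lambda[m]X_m\}$ and let $\hat{\mathfrak J}_\lambda[m]$ be its hat-normalization. In type $A$, $\mathfrak H^{daha}_\lambda[m](q,t,\mathsf a)$ is the unique polynomial in $q,t^{\pm1},\mathsf a$ such that $\mathfrak H^{daha}_\lambda[m](q,t,\mathsf a=-t^{N})=\hat{\mathfrak J}_\lambda[m]$ for the root system $A_{N-1}$ and all $N\ge m$ (with $\omega_N=0$). The diagram $\lambda_{r,s}$: with rows indexed by $i=0,\dots,s-1$, the $i$-th row has $\lfloor r(s-1-i)/s\rfloor$ boxes (zero rows dropped). DAHA superpolynomials of torus knots. The automorphisms $\tau_\pm$ of the double affine Hecke algebra act on $X_m,Y_m$ (for minuscule $\omega_m$) by $\tau_+:X_m\mapsto X_m,\ Y_m\mapsto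 q^{-(\omega_m,\omega_m)/2}X_mY_m$; $\tau_-:Y_m\mapsto Y_m,\ X_m\mapsto q^{(\omega_m,\omega_m)/2}Y_mX_m$. Let $r/s=[a_1;a_2,\dots,a_{2k}]$ be the continued fraction of even length and $\hat\gamma_{r,s}=\tau_+^{a_1}\tau_-^{a_2}\cdots\tau_+^{a_{2k-1}}\tau_-^{a_{2k}}$. The DAHA-Jones polynomial of $T(r,s)$ colored by $\omega_m$ is $\mathcal J_{r,s}(\omega_m)=\{\hat\gamma_{r,s}(E_{\omega_m})\}/E_{\omega_m}(t^{-\rho})$, where the nonsymmetric Macdonald polynomial is $E_{\omega_m}=X_m$ for minuscule $\omega_m$ (so the denominator is a monomial in the parameters); $\hat{\mathcal J}$ is its hat-normalization. In type $A$, $\mathcal H^{daha}_{r,s}(q,t,\mathsf a;\omega_m)$ is the unique polynomial in $q,t^{\pm1},\mathsf a$ whose value at $\mathsf a=-t^{N}$ is $\hat{\mathcal J}_{r,s}(\omega_m)$ for $A_{N-1}$, for all $N\ge m$. *)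

theory Defs
  imports
    Complex_Main
    "HOL-Library.FuncSet"
    "HOL-Library.Function_Algebras"
    "HOL-Library.Product_Plus"
    "HOL-Library.Poly_Mapping"
    "HOL-Computational_Algebra.Polynomial"
begin

text \<open>The type-A superpolynomials compare the root systems \<open>A\<^bsub>N-1\<^esub>\<close> for all \<open>N\<close> at once, so the
  ambient Euclidean space cannot be a type: \<open>\<real>\<^sup>d\<close> consists of the functions \<open>v\<close> with \<open>v i = 0\<close> for
  \<open>i \<ge> d\<close>. Simple roots and fundamental weights are indexed by \<open>1, \<dots>, rnk\<close>.\<close>

type_synonym vec = "nat \<Rightarrow> real"

definition smult_vec :: "real \<Rightarrow> vec \<Rightarrow> vec"  (infixr "*\<^sub>v" 75)
  where "c *\<^sub>v v = (\<lambda>i. c * v i)"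

record root_sys =
  dimn :: nat
  roots :: "vec set"
  rnk :: nat
  sroot :: "nat \<Rightarrow> vec"
  fweight :: "nat \<Rightarrow> vec"

definition ip :: "root_sys \<Rightarrow> vec \<Rightarrow> vec \<Rightarrow> real"
  where "ip D v w = (\<Sum>i<dimn D. v i * w i)"

definition copair :: "root_sys \<Rightarrow> vec \<Rightarrow> vec \<Rightarrow> real"  \<comment> \<open>\<open>(v, a\<^sup>\<or>)\<close>\<close>
  where "copair D v a = 2 * ip D v a / ip D a a"

definition refl_vec :: "root_sys \<Rightarrow> vec \<Rightarrow> vec \<Rightarrow> vec"
  where "refl_vec D a v = v - copair D v a *\<^sub>v a"

definition simple_span :: "root_sys \<Rightarrow> vec set"
  where "simple_span D = {v. \<exists>c::nat \<Rightarrow> real. v = (\<Sum>i=1..rnk D. c i *\<^sub>v sroot D i)}"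

definition nu :: "root_sys \<Rightarrow> vec \<Rightarrow> real"
  where "nu D a = ip D a a / 2"

definition pos_roots :: "root_sys \<Rightarrow> vec set"
  where "pos_roots D =
    {a \<in> roots D. \<exists>k::nat \<Rightarrow> nat. a = (\<Sum>i=1..rnk D. real (k i) *\<^sub>v sroot D i)}"

definition reduced_root_system :: "root_sys \<Rightarrow> bool"
  where "reduced_root_system D \<longleftrightarrow>
    finite (roots D) \<and> 0 \<notin> roots D \<and>
    (\<forall>a\<in>roots D. \<forall>i\<ge>dimn D. a i = 0) \<and>
    (\<forall>a\<in>roots D. \<forall>b\<in>roots D. refl_vec D a b \<in> roots D) \<and>
    (\<forall>a\<in>roots D. \<forall>b\<in>roots D. copair D b a \<in> \<int>) \<and>
    (\<forall>a\<in>roots D. \<forall>c. c *\<^sub>v a \<in> roots D \<longrightarrow> c = 1 \<or> c = -1)"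

definition irreducible_roots :: "root_sys \<Rightarrow> bool"
  where "irreducible_roots D \<longleftrightarrow>
    roots D \<noteq> {} \<and>
    \<not> (\<exists>R1 R2. R1 \<noteq> {} \<and> R2 \<noteq> {} \<and> R1 \<union> R2 = roots D \<and> R1 \<inter> R2 = {} \<and>
          (\<forall>a\<in>R1. \<forall>b\<in>R2. ip D a b = 0))"

definition simple_roots_of :: "root_sys \<Rightarrow> bool"
  where "simple_roots_of D \<longleftrightarrow>
    (\<forall>i\<in>{1..rnk D}. sroot D i \<in> roots D) \<and>
    (\<forall>c::nat \<Rightarrow> real. (\<Sum>i=1..rnk D. c i *\<^sub>v sroot D i) = 0 \<longrightarrow> (\<forall>i\<in>{1..rnk D}. c i = 0)) \<and>
    (\<forall>a\<in>roots D. a \<in> pos_roots D \<or> - a \<in> pos_roots D)"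

definition fundamental_weights_of :: "root_sys \<Rightarrow> bool"
  where "fundamental_weights_of D \<longleftrightarrow>
    (\<forall>i\<in>{1..rnk D}. fweight D i \<in> simple_span D \<and>
       (\<forall>j\<in>{1..rnk D}. copair D (fweight D i) (sroot D j) = (if i = j then 1 else 0)))"

definition short_roots_normalized :: "root_sys \<Rightarrow> bool"
  where "short_roots_normalized D \<longleftrightarrow>
    (\<forall>a\<in>roots D. ip D a a \<ge> 2) \<and> (\<exists>a\<in>roots D. ip D a a = 2)"

definition irreducible_root_system :: "root_sys \<Rightarrow> bool"
  where "irreducible_root_system D \<longleftrightarrow>
    reduced_root_system D \<and> irreducible_roots D \<and> simple_roots_of D \<and>
    fundamental_weights_of D \<and> short_roots_normalized D"

definition weight_lattice :: "root_sys \<Rightarrow> vec set"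
  where "weight_lattice D = {b. \<exists>k::nat \<Rightarrow> int. b = (\<Sum>i=1..rnk D. of_int (k i) *\<^sub>v fweight D i)}"

definition minuscule :: "root_sys \<Rightarrow> nat \<Rightarrow> bool"
  where "minuscule D m \<longleftrightarrow>
    (\<forall>a\<in>pos_roots D. 0 \<le> copair D (fweight D m) a \<and> copair D (fweight D m) a \<le> 1)"

definition rho :: "root_sys \<Rightarrow> real \<Rightarrow> vec"
  where "rho D \<nu> = (1/2) *\<^sub>v (\<Sum>a | a \<in> pos_roots D \<and> nu D a = \<nu>. a)"

text \<open>The root system \<open>A\<^bsub>N-1\<^esub>\<close> in \<open>\<real>\<^sup>N\<close> (coordinates \<open>0, \<dots>, N-1\<close>). The formula for the
  weights is also used at \<open>m = N\<close>, where it yields the convention \<open>\<omega>\<^sub>N = 0\<close>.\<close>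

definition unit_vec :: "nat \<Rightarrow> vec"
  where "unit_vec i = (\<lambda>j. if j = i then 1 else 0)"

definition type_A :: "nat \<Rightarrow> root_sys"
  where "type_A N = \<lparr>
    dimn = N,
    roots = {unit_vec i - unit_vec j |i j. i < N \<and> j < N \<and> i \<noteq> j},
    rnk = N - 1,
    sroot = (\<lambda>i. unit_vec (i - 1) - unit_vec i),
    fweight = (\<lambda>m. (\<Sum>i<m. unit_vec i) - (real m / real N) *\<^sub>v (\<Sum>i<N. unit_vec i)) \<rparr>"

definition weyl_word :: "root_sys \<Rightarrow> nat list \<Rightarrow> vec \<Rightarrow> vec"
  where "weyl_word D is = foldr (\<lambda>i w. refl_vec D (sroot D i) \<circ> w) is id"

definition weyl :: "root_sys \<Rightarrow> (vec \<Rightarrow> vec) set"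
  where "weyl D = {weyl_word D is |is. set is \<subseteq> {1..rnk D}}"

definition weyl_length :: "root_sys \<Rightarrow> (vec \<Rightarrow> vec) \<Rightarrow> nat"
  where "weyl_length D w =
    (LEAST l. \<exists>is. set is \<subseteq> {1..rnk D} \<and> weyl_word D is = w \<and> length is = l)"

definition reduced_word :: "root_sys \<Rightarrow> (vec \<Rightarrow> vec) \<Rightarrow> nat list \<Rightarrow> bool"
  where "reduced_word D w is \<longleftrightarrow>
    set is \<subseteq> {1..rnk D} \<and> weyl_word D is = w \<and> length is = weyl_length D w"

definition longest :: "root_sys \<Rightarrow> vec \<Rightarrow> vec"
  where "longest D = (ARG_MAX (weyl_length D) w. w \<in> weyl D)"

definition u_elt :: "root_sys \<Rightarrow> nat \<Rightarrow> vec \<Rightarrow> vec"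
  where "u_elt D m =
    (ARG_MIN (weyl_length D) u. u \<in> weyl D \<and> u (fweight D m) = longest D (fweight D m))"

text \<open>Coefficients are integral combinations of monomials \<open>q\<^bsup>x\<^esup> \<Prod>\<^sub>\<nu> t\<^sub>\<nu>\<^bsup>e(\<nu>)\<^esup>\<close>, encoded by the exponent
  pair \<open>(x, e)\<close>. There is formally a variable \<open>t\<^sub>\<nu>\<close> for each real \<open>\<nu>\<close>, but only those with
  \<open>\<nu> = \<nu>\<^sub>\<alpha>\<close> for some root \<open>\<alpha>\<close> ever occur; in the simply-laced case \<open>t = t\<^sub>1\<close>. The exponents have
  type real because inner products do; those that occur are rational.\<close>

type_synonym expo = "real \<times> (real \<Rightarrow> real)"
type_synonym qt = "expo \<Rightarrow>\<^sub>0 int"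
type_synonym laurent = "vec \<Rightarrow>\<^sub>0 qt"

definition qt_monom :: "expo \<Rightarrow> qt"
  where "qt_monom e = Poly_Mapping.single e 1"

definition q_pow :: "real \<Rightarrow> qt"
  where "q_pow x = qt_monom (x, 0)"

definition t_pow :: "real \<Rightarrow> real \<Rightarrow> qt"  \<comment> \<open>\<open>t\<^sub>\<nu>\<^sup>x\<close>\<close>
  where "t_pow \<nu> x = qt_monom (0, (\<lambda>\<mu>. if \<mu> = \<nu> then x else 0))"

definition X_monom :: "vec \<Rightarrow> laurent"
  where "X_monom b = Poly_Mapping.single b 1"

definition smult_laurent :: "qt \<Rightarrow> laurent \<Rightarrow> laurent"
  where "smult_laurent c f = Poly_Mapping.single 0 c * f"

definition laurent_ring :: "root_sys \<Rightarrow> laurent set"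
  where "laurent_ring D = {f. Poly_Mapping.keys f \<subseteq> weight_lattice D}"

definition lin_ext :: "(vec \<Rightarrow> laurent) \<Rightarrow> laurent \<Rightarrow> laurent"
  where "lin_ext \<phi> f = (\<Sum>b\<in>Poly_Mapping.keys f. smult_laurent (Poly_Mapping.lookup f b) (\<phi> b))"

definition weyl_act :: "(vec \<Rightarrow> vec) \<Rightarrow> laurent \<Rightarrow> laurent"
  where "weyl_act w = lin_ext (\<lambda>b. X_monom (w b))"

definition quot_X :: "root_sys \<Rightarrow> vec \<Rightarrow> laurent \<Rightarrow> laurent"
  where "quot_X D a f = (THE g. g \<in> laurent_ring D \<and> (X_monom a - 1) * g = f)"

text \<open>An operator is a function on \<^term>\<open>laurent_ring D\<close>, extensional in the sense of FuncSet, so that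
  equality of operators is equality on the Laurent polynomials spanned by \<open>X\<^sub>b\<close>, \<open>b \<in> P\<close>.\<close>

type_synonym oper = "laurent \<Rightarrow> laurent"

definition op_one :: "root_sys \<Rightarrow> oper"
  where "op_one D = (\<lambda>f\<in>laurent_ring D. f)"

definition op_mult :: "root_sys \<Rightarrow> oper \<Rightarrow> oper \<Rightarrow> oper"
  where "op_mult D A B = compose (laurent_ring D) A B"

definition op_add :: "root_sys \<Rightarrow> oper \<Rightarrow> oper \<Rightarrow> oper"
  where "op_add D A B = (\<lambda>f\<in>laurent_ring D. A f + B f)"

definition op_scale :: "root_sys \<Rightarrow> qt \<Rightarrow> oper \<Rightarrow> oper"
  where "op_scale D c A = (\<lambda>f\<in>laurent_ring D. smult_laurent c (A f))"

definition op_prod :: "root_sys \<Rightarrow> oper list \<Rightarrow> oper"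
  where "op_prod D As = foldr (op_mult D) As (op_one D)"

definition op_X :: "root_sys \<Rightarrow> vec \<Rightarrow> oper"
  where "op_X D b = (\<lambda>f\<in>laurent_ring D. X_monom b * f)"

definition op_T :: "root_sys \<Rightarrow> nat \<Rightarrow> oper"
  where "op_T D i = (\<lambda>f\<in>laurent_ring D.
    let a = sroot D i; th = t_pow (nu D a) (1/2); th' = t_pow (nu D a) (-1/2);
        sf = weyl_act (refl_vec D a) f
    in smult_laurent th sf + smult_laurent (th - th') (quot_X D a (sf - f)))"

text \<open>\<open>T\<^sub>w\<close> does not depend on the choice of the reduced word, by the braid relations.\<close>

definition op_Tw :: "root_sys \<Rightarrow> (vec \<Rightarrow> vec) \<Rightarrow> oper"
  where "op_Tw D w = op_prod D (map (op_T D) (SOME is. reduced_word D w is))"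

definition op_pi :: "root_sys \<Rightarrow> nat \<Rightarrow> oper"
  where "op_pi D m = (\<lambda>f\<in>laurent_ring D. lin_ext
    (\<lambda>b. smult_laurent (q_pow (- ip D (longest D (fweight D m)) b)) (X_monom (inv (u_elt D m) b))) f)"

definition op_Xm :: "root_sys \<Rightarrow> nat \<Rightarrow> oper"
  where "op_Xm D m = op_X D (fweight D m)"

definition op_Ym :: "root_sys \<Rightarrow> nat \<Rightarrow> oper"
  where "op_Ym D m = op_mult D (op_pi D m) (op_Tw D (u_elt D m))"

text \<open>The double affine Hecke algebra in its (faithful) polynomial representation. If \<open>R\<close> has a
  minuscule weight, the \<open>\<pi>\<^sub>m\<close> together with 1 form the group \<open>\<Pi> \<cong> P/Q\<close> and some \<open>\<pi>\<^sub>m\<close> conjugates \<open>T\<^sub>0\<close> into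
  a \<open>T\<^sub>i\<close> with \<open>i \<ge> 1\<close>, so neither \<open>T\<^sub>0\<close> nor inverses need to be listed among the generators.\<close>

inductive_set daha :: "root_sys \<Rightarrow> oper set" for D :: root_sys
where
  daha_X: "b \<in> weight_lattice D \<Longrightarrow> op_X D b \<in> daha D"
| daha_T: "i \<in> {1..rnk D} \<Longrightarrow> op_T D i \<in> daha D"
| daha_pi: "m \<in> {1..rnk D} \<Longrightarrow> minuscule D m \<Longrightarrow> op_pi D m \<in> daha D"
| daha_one: "op_one D \<in> daha D"
| daha_mult: "A \<in> daha D \<Longrightarrow> B \<in> daha D \<Longrightarrow> op_mult D A B \<in> daha D"
| daha_add: "A \<in> daha D \<Longrightarrow> B \<in> daha D \<Longrightarrow> op_add D A B \<in> daha D"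
| daha_scale: "A \<in> daha D \<Longrightarrow> op_scale D c A \<in> daha D"

definition daha_automorphism :: "root_sys \<Rightarrow> (oper \<Rightarrow> oper) \<Rightarrow> bool"
  where "daha_automorphism D \<tau> \<longleftrightarrow>
    bij_betw \<tau> (daha D) (daha D) \<and>
    \<tau> (op_one D) = op_one D \<and>
    (\<forall>A\<in>daha D. \<forall>B\<in>daha D. \<tau> (op_mult D A B) = op_mult D (\<tau> A) (\<tau> B)) \<and>
    (\<forall>A\<in>daha D. \<forall>B\<in>daha D. \<tau> (op_add D A B) = op_add D (\<tau> A) (\<tau> B)) \<and>
    (\<forall>c. \<forall>A\<in>daha D. \<tau> (op_scale D c A) = op_scale D c (\<tau> A))"

text \<open>Only the values of \<open>\<tau>\<^sub>\<plusminus>\<close> on the \<open>X\<^sub>m\<close>, \<open>Y\<^sub>m\<close> with \<open>\<omega>\<^sub>m\<close> minuscule are prescribed; they determine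
  \<open>\<tau>\<^sub>\<plusminus>\<close> on the subalgebra in which the DAHA-Jones polynomials are computed.\<close>

definition is_tau_plus :: "root_sys \<Rightarrow> (oper \<Rightarrow> oper) \<Rightarrow> bool"
  where "is_tau_plus D \<tau> \<longleftrightarrow> daha_automorphism D \<tau> \<and>
    (\<forall>m\<in>{1..rnk D}. minuscule D m \<longrightarrow>
       \<tau> (op_Xm D m) = op_Xm D m \<and>
       \<tau> (op_Ym D m) = op_scale D (q_pow (- ip D (fweight D m) (fweight D m) / 2))
                          (op_mult D (op_Xm D m) (op_Ym D m)))"

definition is_tau_minus :: "root_sys \<Rightarrow> (oper \<Rightarrow> oper) \<Rightarrow> bool"
  where "is_tau_minus D \<tau> \<longleftrightarrow> daha_automorphism D \<tau> \<and>
    (\<forall>m\<in>{1..rnk D}. minuscule D m \<longrightarrow>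
       \<tau> (op_Ym D m) = op_Ym D m \<and>
       \<tau> (op_Xm D m) = op_scale D (q_pow (ip D (fweight D m) (fweight D m) / 2))
                          (op_mult D (op_Ym D m) (op_Xm D m)))"

text \<open>The values \<open>\<Prod>\<^sub>\<nu> t\<^sub>\<nu>\<^bsup>-(\<rho>\<^sub>\<nu>,b)/\<nu>\<^esup>\<close>. If no root has \<open>\<nu>\<^sub>\<alpha> = \<nu>\<close>, then \<open>\<rho>\<^sub>\<nu> = 0\<close> and the exponent
  of \<open>t\<^sub>\<nu>\<close> vanishes.\<close>

definition eval_X :: "root_sys \<Rightarrow> vec \<Rightarrow> qt"
  where "eval_X D b = qt_monom (0, (\<lambda>\<nu>. - ip D (rho D \<nu>) b / \<nu>))"

definition eval_rho :: "root_sys \<Rightarrow> laurent \<Rightarrow> qt"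
  where "eval_rho D f = (\<Sum>b\<in>Poly_Mapping.keys f. Poly_Mapping.lookup f b * eval_X D b)"

definition coinvariant :: "root_sys \<Rightarrow> oper \<Rightarrow> qt"
  where "coinvariant D A = eval_rho D (A 1)"

text \<open>Total on exponents with finite support; for a single \<open>t\<close> it is the usual order of the powers of
  \<open>t\<close>. With several \<open>t\<^sub>\<nu>\<close> it fixes which pure \<open>t\<close>-monomial is meant by the minimal one.\<close>

definition t_less :: "(real \<Rightarrow> real) \<Rightarrow> (real \<Rightarrow> real) \<Rightarrow> bool"
  where "t_less e e' \<longleftrightarrow> (\<exists>\<nu>. e \<nu> < e' \<nu> \<and> (\<forall>\<mu><\<nu>. e \<mu> = e' \<mu>))"

definition is_hat :: "qt \<Rightarrow> qt \<Rightarrow> bool"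
  where "is_hat f g \<longleftrightarrow>
    (\<exists>c d e. c \<noteq> 0 \<and> d \<noteq> 0 \<and> of_int c * f = of_int d * qt_monom e * g) \<and>
    (\<forall>x\<in>Poly_Mapping.keys g. fst x \<in> \<nat> \<and> (\<forall>\<nu>. snd x \<nu> \<in> \<nat>)) \<and>
    (\<exists>x\<in>Poly_Mapping.keys g. fst x = 0) \<and>
    (\<forall>\<nu>. \<exists>x\<in>Poly_Mapping.keys g. snd x \<nu> = 0) \<and>
    Gcd (Poly_Mapping.lookup g ` Poly_Mapping.keys g) = 1 \<and>
    (\<exists>x\<in>Poly_Mapping.keys g. fst x = 0 \<and> Poly_Mapping.lookup g x > 0 \<and>
       (\<forall>y\<in>Poly_Mapping.keys g. fst y = 0 \<longrightarrow> y = x \<or> t_less (snd x) (snd y)))"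

text \<open>Definite descriptions are option-valued, so that an equation between two of them also says
  that one is well-defined if and only if the other is.\<close>

definition the_unique :: "('a \<Rightarrow> bool) \<Rightarrow> 'a option"
  where "the_unique Q = (if \<exists>!x. Q x then Some (THE x. Q x) else None)"

definition hat :: "qt \<Rightarrow> qt option"
  where "hat f = the_unique (is_hat f)"

text \<open>A polynomial in \<open>q, t\<^sup>\<plusminus>\<^sup>1, \<a>\<close> is a polynomial in \<open>\<a>\<close> with coefficients in \<open>\<int>[q, t\<^sup>\<plusminus>\<^sup>1]\<close>, \<open>t = t\<^sub>1\<close>.\<close>

definition superpoly_ring :: "qt poly set"
  where "superpoly_ring = {H. \<forall>k. \<forall>x\<in>Poly_Mapping.keys (coeff H k).
    fst x \<in> \<nat> \<and> snd x 1 \<in> \<int> \<and> (\<forall>\<nu>. \<nu> \<noteq> 1 \<longrightarrow> snd x \<nu> = 0)}"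

definition superpolynomial :: "nat \<Rightarrow> (nat \<Rightarrow> qt) \<Rightarrow> qt poly option"
  where "superpolynomial m J = the_unique (\<lambda>H. H \<in> superpoly_ring \<and>
    (\<forall>N\<ge>m. hat (J N) = Some (poly H (- t_pow 1 (real N)))))"

datatype letter = LX | LY

text \<open>A Young diagram is the list of its (nonzero) row lengths.\<close>

fun diagram_word :: "nat list \<Rightarrow> letter list"
where
  "diagram_word [] = []"
| "diagram_word [a] = LY # replicate a LX"
| "diagram_word (a # b # l) = LY # replicate (a - b) LX @ diagram_word (b # l)"

definition word_oper :: "root_sys \<Rightarrow> nat \<Rightarrow> letter list \<Rightarrow> oper"
  where "word_oper D m w =
    op_prod D (map (\<lambda>x. case x of LX \<Rightarrow> op_Xm D m | LY \<Rightarrow> op_Ym D m) w)"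

definition diagram_J :: "root_sys \<Rightarrow> nat \<Rightarrow> nat list \<Rightarrow> qt"
  where "diagram_J D m l =
    coinvariant D (op_mult D (word_oper D m (diagram_word l)) (op_Xm D m))"

definition diagram_superpoly :: "nat \<Rightarrow> nat list \<Rightarrow> qt poly option"
  where "diagram_superpoly m l = superpolynomial m (\<lambda>N. diagram_J (type_A N) m l)"

definition torus_diagram :: "nat \<Rightarrow> nat \<Rightarrow> nat list"
  where "torus_diagram r s = filter (\<lambda>k. k > 0) (map (\<lambda>i. r * (s - 1 - i) div s) [0..<s])"

fun cf_value :: "nat list \<Rightarrow> rat"
where
  "cf_value [] = 0"
| "cf_value [a] = of_nat a"
| "cf_value (a # b # l) = of_nat a + 1 / cf_value (b # l)"

definition is_even_cf :: "nat \<Rightarrow> nat \<Rightarrow> nat list \<Rightarrow> bool"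
  where "is_even_cf r s l \<longleftrightarrow>
    l \<noteq> [] \<and> even (length l) \<and> (\<forall>a\<in>set (tl l). a > 0) \<and> cf_value l = of_nat r / of_nat s"

definition even_cf :: "nat \<Rightarrow> nat \<Rightarrow> nat list"
  where "even_cf r s = (THE l. is_even_cf r s l)"

text \<open>The two automorphisms alternate; the rightmost factor is applied first.\<close>

fun gamma_hat :: "('a \<Rightarrow> 'a) \<Rightarrow> ('a \<Rightarrow> 'a) \<Rightarrow> nat list \<Rightarrow> 'a \<Rightarrow> 'a"
where
  "gamma_hat \<tau>p \<tau>m [] = id"
| "gamma_hat \<tau>p \<tau>m (a # l) = (\<tau>p ^^ a) \<circ> gamma_hat \<tau>m \<tau>p l"

text \<open>The nonsymmetric Macdonald polynomial \<open>E\<^bsub>\<omega>\<^sub>m\<^esub>\<close> is \<open>X\<^bsub>\<omega>\<^sub>m\<^esub>\<close>, as \<open>\<omega>\<^sub>m\<close> is minuscule. Its value at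
  \<open>t\<^bsup>-\<rho>\<^esup>\<close> is the monomial \<^term>\<open>eval_X D (fweight D m)\<close>, the inverse of
  \<^term>\<open>eval_X D (- fweight D m)\<close>.\<close>

definition daha_jones ::
    "root_sys \<Rightarrow> (oper \<Rightarrow> oper) \<Rightarrow> (oper \<Rightarrow> oper) \<Rightarrow> nat \<Rightarrow> nat \<Rightarrow> nat \<Rightarrow> qt"
  where "daha_jones D \<tau>p \<tau>m r s m =
    coinvariant D (gamma_hat \<tau>p \<tau>m (even_cf r s) (op_Xm D m)) * eval_X D (- fweight D m)"

definition torus_superpoly ::
    "(nat \<Rightarrow> oper \<Rightarrow> oper) \<Rightarrow> (nat \<Rightarrow> oper \<Rightarrow> oper) \<Rightarrow> nat \<Rightarrow> nat \<Rightarrow> nat \<Rightarrow> qt poly option"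
  where "torus_superpoly \<tau>p \<tau>m r s m =
    superpolynomial m (\<lambda>N. daha_jones (type_A N) (\<tau>p N) (\<tau>m N) r s m)"

end

theory Submission
  imports Defs
begin

text \<open>Under \<open>\<tau>\<^sub>+\<close> and \<open>\<tau>\<^sub>-\<close>, words in \<open>X\<^sub>m, Y\<^sub>m\<close> go, up to powers of \<open>q\<close>, to the words obtained by
  \<open>X \<mapsto> X, Y \<mapsto> XY\<close> and \<open>X \<mapsto> YX, Y \<mapsto> Y\<close>. Hence the image of \<open>X\<^sub>m\<close> under \<open>\<gamma>\<^bsub>r,s\<^esub>\<close> is a multiple of the
  cutting word of slope \<open>r/s\<close>, whose border is that of the diagram \<open>\<lambda>\<^bsub>r,s\<^esub>\<close>: it has the form
  \<open>X\<^sup>p W\<^sub>\<lambda> Y\<^sup>z X\<close>. The prefix \<open>X\<^sup>p\<close> changes the coinvariant by a monomial, and so does \<open>Y\<^sup>z\<close>, because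
  \<open>X\<^bsub>\<omega>\<^sub>m\<^esub>\<close> is an eigenvector of \<open>Y\<^sub>m\<close> for minuscule \<open>\<omega>\<^sub>m\<close>. In type \<open>A\<^bsub>m-1\<^esub>\<close>, where \<open>\<omega>\<^sub>m = 0\<close>, both sides
  are trivial.\<close>

section \<open>Cutting words and continued fractions\<close>

text \<open>The automorphisms are known only through their values on letters, while u_m, T_w, the
  quotient in T_i and the continued fraction are given by choice or description. Hence everything is
  reduced to words and monomials. Why a cutting word arises: each substitution acts on lattice
  points as a shear, (k, j) to (k + j, j) or to (k, k + j), and s k - r j keeps its value when (r,
  s) is replaced by (r + s, s) or (r, r + s). Iteration retraces the subtractive Euclidean
  algorithm, whose step counts are the entries of the continued fraction. Why X_{\<omega>_m} is an
  eigenvector: u_m is a shortest way from \<omega>_m to w_0(\<omega>_m), and along a shortest way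
  each weight b pairs to 1 with the next simple coroot. The division in T_i then yields -X_{s_i(b)},
  so T_i multiplies by t_i^(-1/2) and replaces b by s_i(b). Finally \<pi>_m moves the weight back to
  \<omega>_m. Why the option-valued equations follow: monomials are invertible, so the two
  coinvariants satisfy the same predicate \<open>is_hat\<close>, and their normalizations agree,
  whether defined or undefined.\<close>

fun sub_plus_letter :: "letter \<Rightarrow> letter list"
where
  "sub_plus_letter LX = [LX]"
| "sub_plus_letter LY = [LX, LY]"

fun sub_minus_letter :: "letter \<Rightarrow> letter list"
where
  "sub_minus_letter LX = [LY, LX]"
| "sub_minus_letter LY = [LY]"

definition subst_word :: "(letter \<Rightarrow> letter list) \<Rightarrow> letter list \<Rightarrow> letter list"
  where "subst_word \<sigma> w = concat (map \<sigma> w)"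

lemma subst_word_simps [simp]:
  "subst_word \<sigma> [] = []" "subst_word \<sigma> (x # w) = \<sigma> x @ subst_word \<sigma> w"
  by (simp_all add: subst_word_def)

lemma rev_subst_word: "rev (subst_word \<sigma> w) = subst_word (rev \<circ> \<sigma>) (rev w)"
  by (induction w) (simp_all add: subst_word_def)

text \<open>The shadow on words of the element whose coinvariant defines the DAHA-Jones polynomial:
  the same alternation as there, with substitutions in place of automorphisms, so that both can be
  followed in parallel.\<close>

definition torus_word :: "nat list \<Rightarrow> letter list"
  where "torus_word l = gamma_hat (subst_word sub_plus_letter) (subst_word sub_minus_letter) l [LX]"

lemma count_list_replicate [simp]: "count_list (replicate n x) y = (if x = y then n else 0)"
  by (induction n) auto

text \<open>The argument is a word read from right to left, as a lattice path that has already passed \<open>k\<close>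
  letters \<open>X\<close> and \<open>j\<close> letters \<open>Y\<close>; the next letter is dictated by the side of the line
  \<open>s k = r j\<close> on which the point \<open>(k, j)\<close> lies.\<close>

fun cutting_path :: "nat \<Rightarrow> nat \<Rightarrow> nat \<Rightarrow> nat \<Rightarrow> letter list \<Rightarrow> bool"
where
  "cutting_path r s k j [] = True"
| "cutting_path r s k j (LX # w) = (s * k \<le> r * j \<and> cutting_path r s (Suc k) j w)"
| "cutting_path r s k j (LY # w) = (r * j < s * k \<and> cutting_path r s k (Suc j) w)"

text \<open>At each lattice point exactly one of the two inequalities holds, so every letter is
  forced by those before it.\<close>

lemma cutting_path_unique:
  "cutting_path r s k j v \<Longrightarrow> cutting_path r s k j w \<Longrightarrow> length v = length w \<Longrightarrow> v = w"
proof (induction r s k j v arbitrary: w rule: cutting_path.induct)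
  case (2 r s k j v)
  then show ?case by (cases w; cases "hd w") auto
next
  case (3 r s k j v)
  then show ?case by (cases w; cases "hd w") auto
qed auto

lemma cutting_path_append:
  "cutting_path r s k j (v @ w) \<longleftrightarrow> cutting_path r s k j v \<and>
     cutting_path r s (k + count_list v LX) (j + count_list v LY) w"
  by (induction r s k j v rule: cutting_path.induct) auto

text \<open>The tightest condition in the run is that of its last X, read at abscissa k + c - 1; the
  hypothesis expresses it without subtraction.\<close>

lemma cutting_path_replicate_LX:
  "s * (k + c) \<le> r * j + s \<Longrightarrow> cutting_path r s k j (replicate c LX)"
proof (induction c arbitrary: k)
  case (Suc c)
  have "s * (k + 1) \<le> s * (k + Suc c)" by (intro mult_le_mono2) simp
  with Suc.prems have "s * k \<le> r * j" by (simp add: algebra_simps)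
  with Suc show ?case by (simp add: algebra_simps)
qed simp

text \<open>The shear (k, j) to (k + j, j) preserves the side of the line, since s (k + j) - (r + s)
  j = s k - r j. Only the X inserted after each Y must be checked, and the hypothesis, which says
  how far the path may overshoot the line, is the invariant that permits it.\<close>

lemma cutting_path_sub_plus:
  "cutting_path r s k j w \<Longrightarrow> s * k \<le> r * j + s \<Longrightarrow>
    cutting_path (r + s) s (k + j) j (subst_word (rev \<circ> sub_plus_letter) w)"
proof (induction r s k j w rule: cutting_path.induct)
  case (2 r s k j w)
  then show ?case by (simp add: algebra_simps)
next
  case (3 r s k j w)
  then show ?case by (simp add: algebra_simps)
qed simp

text \<open>The transposed shear (k, j) to (k, k + j). The overshoot is now bounded on the other
  side of the line, strictly, which at the origin amounts to r > 0.\<close>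

lemma cutting_path_sub_minus:
  "cutting_path r s k j w \<Longrightarrow> r * j < s * k + r \<Longrightarrow>
    cutting_path r (r + s) k (k + j) (subst_word (rev \<circ> sub_minus_letter) w)"
proof (induction r s k j w rule: cutting_path.induct)
  case (2 r s k j w)
  then show ?case by (simp add: algebra_simps)
next
  case (3 r s k j w)
  then show ?case by (simp add: algebra_simps)
qed simp

definition is_cutting_word :: "nat \<Rightarrow> nat \<Rightarrow> letter list \<Rightarrow> bool"
  where "is_cutting_word r s w \<longleftrightarrow>
    cutting_path r s 0 0 (rev w) \<and> count_list w LX = r \<and> count_list w LY = s"

lemma length_letters: "length w = count_list w LX + count_list w LY"
proof (induction w)
  case (Cons x w)
  then show ?case by (cases x) auto
qed simp

lemma is_cutting_word_unique:
  assumes "is_cutting_word r s v" "is_cutting_word r s w" shows "v = w"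
proof -
  have "rev v = rev w"
    using assms by (intro cutting_path_unique[of r s 0 0])
      (auto simp: is_cutting_word_def length_letters)
  then show ?thesis by simp
qed

lemma count_list_sub_plus:
  "count_list (subst_word sub_plus_letter w) LX = count_list w LX + count_list w LY"
  "count_list (subst_word sub_plus_letter w) LY = count_list w LY"
proof (induction w)
  case (Cons x w)
  { case 1 show ?case using Cons by (cases x) auto }
  { case 2 show ?case using Cons by (cases x) auto }
qed simp_all

lemma count_list_sub_minus:
  "count_list (subst_word sub_minus_letter w) LX = count_list w LX"
  "count_list (subst_word sub_minus_letter w) LY = count_list w LX + count_list w LY"
proof (induction w)
  case (Cons x w)
  { case 1 show ?case using Cons by (cases x) auto }
  { case 2 show ?case using Cons by (cases x) auto }
qed simp_all

lemma is_cutting_word_sub_plus: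
  assumes "is_cutting_word r s w"
  shows "is_cutting_word (r + s) s (subst_word sub_plus_letter w)"
  using assms cutting_path_sub_plus[of r s 0 0 "rev w"]
  by (simp add: is_cutting_word_def rev_subst_word count_list_sub_plus)

lemma is_cutting_word_sub_minus:
  assumes "is_cutting_word r s w" "r > 0"
  shows "is_cutting_word r (r + s) (subst_word sub_minus_letter w)"
  using assms cutting_path_sub_minus[of r s 0 0 "rev w"]
  by (simp add: is_cutting_word_def rev_subst_word count_list_sub_minus)

section \<open>Continued fractions of even length and the Euclidean algorithm\<close>

lemma cf_value_Suc: "cf_value (Suc a # l) = cf_value (a # l) + 1"
  by (cases l) simp_all

lemma cf_value_ge_1: "l \<noteq> [] \<Longrightarrow> \<forall>a\<in>set l. a > 0 \<Longrightarrow> cf_value l \<ge> 1"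
proof (induction l rule: cf_value.induct)
  case (2 a)
  then show ?case by simp
next
  case (3 a b l)
  then have "1 \<le> (of_nat a :: rat)" "cf_value (b # l) \<ge> 1" by simp_all
  moreover from this have "1 / cf_value (b # l) \<ge> 0" by simp
  ultimately show ?case by (simp only: cf_value.simps)
qed simp

text \<open>Even length provides a second entry, hence a positive fraction on top of the first one.
  For odd length the value 1 of \<open>[1]\<close> is possible; this is the ambiguity that the
  parity removes.\<close>

lemma cf_value_gt_1:
  assumes "\<forall>a\<in>set l. a > 0" "even (length l)" "l \<noteq> []"
  shows "cf_value l > 1"
proof -
  obtain a b l' where l: "l = a # b # l'"
    using assms by (cases l rule: cf_value.cases) auto
  have "1 \<le> (of_nat a :: rat)" "cf_value (b # l') \<ge> 1"
    using assms l cf_value_ge_1[of "b # l'"] by simp_all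
  moreover from this have "1 / cf_value (b # l') > 0" by simp
  ultimately show ?thesis unfolding l by (simp only: cf_value.simps)
qed

lemma of_nat_add_fraction_unique:
  fixes x y :: rat
  assumes "of_nat a + x = of_nat b + y" "\<bar>x - y\<bar> < 1"
  shows "a = b \<and> x = y"
proof -
  have "\<bar>of_int (int a - int b)\<bar> < (1::rat)" using assms by simp
  then have "a = b" by linarith
  with assms show ?thesis by simp
qed

text \<open>Counting from 0, an entry in even position is followed by a fraction in the interval (0,
  1], one in odd position by a fraction in [0, 1), which is 0 when the expansion ends. In either
  case two such fractions differ by less than 1, so the entry can be read off from the
  value.\<close>

lemma even_cf_value_inject:
  "cf_value l = cf_value l' \<Longrightarrow> even (length l) \<Longrightarrow> even (length l') \<Longrightarrow> l \<noteq> [] \<Longrightarrow> l' \<noteq> [] \<Longrightarrow>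
    \<forall>a\<in>set (tl l). a > 0 \<Longrightarrow> \<forall>a\<in>set (tl l'). a > 0 \<Longrightarrow> l = l'"
proof (induction "length l" arbitrary: l l' rule: less_induct)
  case less
  obtain a b k where l: "l = a # b # k"
    using less.prems by (cases l rule: cf_value.cases) auto
  obtain a' b' k' where l': "l' = a' # b' # k'"
    using less.prems by (cases l' rule: cf_value.cases) auto
  define y where "y = (if k = [] then 0 else 1 / cf_value k)"
  define y' where "y' = (if k' = [] then 0 else 1 / cf_value k')"
  have y: "cf_value (b # k) = of_nat b + y" by (cases k) (simp_all add: y_def)
  have y': "cf_value (b' # k') = of_nat b' + y'" by (cases k') (simp_all add: y'_def)
  have k: "cf_value k > 1" if "k \<noteq> []" using less.prems l cf_value_gt_1 that by simp
  have k': "cf_value k' > 1" if "k' \<noteq> []" using less.prems l' cf_value_gt_1 that by simp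
  have ge: "cf_value (b # k) \<ge> 1" "cf_value (b' # k') \<ge> 1"
    using less.prems l l' by (auto intro!: cf_value_ge_1)
  then have "0 < 1 / cf_value (b # k)" "1 / cf_value (b # k) \<le> 1"
      "0 < 1 / cf_value (b' # k')" "1 / cf_value (b' # k') \<le> 1"
    by (simp_all add: field_simps)
  then have "\<bar>1 / cf_value (b # k) - 1 / cf_value (b' # k')\<bar> < 1" by linarith
  then have "a = a' \<and> 1 / cf_value (b # k) = 1 / cf_value (b' # k')"
    using less.prems(1) l l' by (intro of_nat_add_fraction_unique) simp_all
  then have a: "a = a'" and "cf_value (b # k) = cf_value (b' # k')" using ge by simp_all
  moreover have "0 \<le> y" "y < 1" "0 \<le> y'" "y' < 1"
    using k k' by (auto simp: y_def y'_def)
  ultimately have b: "b = b'" and yy: "y = y'"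
    using of_nat_add_fraction_unique[of b y b' y'] y y' by simp_all
  have "k = k'"
  proof (cases "k = [] \<or> k' = []")
    case True
    with yy k k' show ?thesis by (auto simp: y_def y'_def split: if_splits)
  next
    case False
    moreover from False yy have "cf_value k = cf_value k'" by (simp add: y_def y'_def)
    moreover have "\<forall>a\<in>set (tl k). a > 0" "\<forall>a\<in>set (tl k'). a > 0"
      using less.prems l l' by (cases k; cases k'; auto)+
    ultimately show ?thesis using less l l' by simp
  qed
  with a b l l' show ?case by simp
qed

lemma torus_word_sub_plus: "torus_word (Suc a # l) = subst_word sub_plus_letter (torus_word (a # l))"
  by (simp add: torus_word_def)

lemma torus_word_sub_minus:
  "torus_word (0 # Suc a # l) = subst_word sub_minus_letter (torus_word (0 # a # l))"
  by (simp add: torus_word_def)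

lemma torus_word_zero_zero: "torus_word (0 # 0 # l) = torus_word l"
  by (simp add: torus_word_def)

text \<open>Subtractive Euclidean algorithm on (r, s). Expansion and word are built together: the
  step undoing r - s changes the expansion so that one more \<open>sub_plus_letter\<close> is
  applied outermost, the step undoing s - r does so for \<open>sub_minus_letter\<close>.\<close>

lemma even_cf_exists:
  "r > 0 \<Longrightarrow> s > 0 \<Longrightarrow> coprime r s \<Longrightarrow> \<exists>l. is_even_cf r s l \<and> is_cutting_word r s (torus_word l)"
proof (induction "r + s" arbitrary: r s rule: less_induct)
  case less
  consider "r = s" | "r > s" | "r < s" by linarith
  then show ?case
  proof cases
    case 1
    with less.prems have "r = 1" "s = 1" by auto
    \<comment> \<open>The expansion of 1 by a single entry has odd length; this is its even
      form.\<close>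
    then have "is_even_cf r s [0, 1]" "is_cutting_word r s (torus_word [0, 1])"
      by (simp_all add: is_even_cf_def is_cutting_word_def torus_word_def)
    then show ?thesis by blast
  next
    case 2
    then have "coprime (r - s) s"
      using less.prems by (metis coprime_iff_gcd_eq_1 gcd_diff1_nat less_imp_le_nat)
    with 2 less obtain l where l: "is_even_cf (r - s) s l" "is_cutting_word (r - s) s (torus_word l)"
      by (metis add_less_mono1 diff_less zero_less_diff)
    then obtain a k where k: "l = a # k" by (cases l) (auto simp: is_even_cf_def)
    have "is_even_cf r s (Suc a # k)"
      using l(1) 2 less.prems by (simp add: is_even_cf_def k cf_value_Suc field_simps of_nat_diff)
    moreover have "is_cutting_word r s (torus_word (Suc a # k))"
      using is_cutting_word_sub_plus[OF l(2)] 2 by (simp add: k torus_word_sub_plus)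
    ultimately show ?thesis by blast
  next
    case 3
    then have "coprime r (s - r)"
      using less.prems by (metis coprime_iff_gcd_eq_1 gcd.commute gcd_diff1_nat less_imp_le_nat)
    with 3 less obtain l where l: "is_even_cf r (s - r) l" "is_cutting_word r (s - r) (torus_word l)"
      by (metis add_less_cancel_left diff_less zero_less_diff)
    have cut: "is_cutting_word r s (subst_word sub_minus_letter (torus_word l))"
      using is_cutting_word_sub_minus[OF l(2)] 3 less.prems by simp
    obtain a b k where k: "l = a # b # k"
      using l(1) by (cases l rule: cf_value.cases) (auto simp: is_even_cf_def)
    have rs: "(of_nat r :: rat) > 0" "(of_nat s :: rat) > of_nat r" using less.prems 3 by simp_all
    have v: "cf_value l = of_nat r / (of_nat s - of_nat r)"
      using l(1) 3 by (simp add: is_even_cf_def of_nat_diff)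
    show ?thesis
    proof (cases "a = 0")
      case True
      have "1 / cf_value (b # k) = of_nat r / (of_nat s - of_nat r)" using v by (simp add: k True)
      then have "cf_value (b # k) = (of_nat s - of_nat r) / of_nat r"
        by (metis div_by_1 divide_divide_eq_right mult_1)
      then have "cf_value (Suc b # k) = of_nat s / of_nat r"
        using rs by (simp add: cf_value_Suc diff_divide_distrib)
      then have "cf_value (0 # Suc b # k) = of_nat r / of_nat s" by simp
      then have "is_even_cf r s (0 # Suc b # k)"
        using l(1) by (auto simp: is_even_cf_def k)
      moreover have "is_cutting_word r s (torus_word (0 # Suc b # k))"
        using cut by (simp add: k True torus_word_sub_minus)
      ultimately show ?thesis by blast
    next
      case False
      \<comment> \<open>Here the outermost block of \<open>l\<close> belongs to the other
        substitution, so a new block of length 1 is opened, preceded by an empty one: r / s = 1 / (1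
        + (s - r) / r).\<close>
      have "cf_value (0 # 1 # l) = 1 / (1 + 1 / cf_value l)" by (simp add: k)
      also have "\<dots> = of_nat r / of_nat s" unfolding v using rs by (simp add: field_simps)
      finally have "is_even_cf r s (0 # 1 # l)"
        using l(1) False by (auto simp: is_even_cf_def k)
      moreover have "is_cutting_word r s (torus_word (0 # 1 # l))"
        using cut by (simp add: torus_word_sub_minus torus_word_zero_zero)
      ultimately show ?thesis by blast
    qed
  qed
qed

lemma is_cutting_word_torus_word:
  assumes "r > 0" "s > 0" "coprime r s"
  shows "is_cutting_word r s (torus_word (even_cf r s))"
proof -
  obtain l where l: "is_even_cf r s l" "is_cutting_word r s (torus_word l)"
    using even_cf_exists assms by blast
  have "even_cf r s = l"
    unfolding even_cf_def using l(1)
    by (rule the_equality) (use l(1) in \<open>auto simp: is_even_cf_def intro: even_cf_value_inject\<close>)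
  with l show ?thesis by simp
qed

section \<open>The border of the diagram above the diagonal\<close>

definition diagonal_rows :: "nat \<Rightarrow> nat \<Rightarrow> nat \<Rightarrow> nat list"
  where "diagonal_rows r s n = map (\<lambda>i. r * (n - 1 - i) div s) [0..<n]"

text \<open>The parameter n counts rows from the bottom, zero rows included, so that the diagram
  grows by a new top row; for n = s it is the whole diagram.\<close>

lemma diagonal_rows_Suc: "diagonal_rows r s (Suc n) = r * n div s # diagonal_rows r s n"
  unfolding diagonal_rows_def by (subst upt_conv_Cons) (auto simp flip: map_Suc_upt simp del: upt_Suc)

lemma torus_diagram_eq: "torus_diagram r s = filter (\<lambda>k. k > 0) (diagonal_rows r s s)"
  by (simp add: torus_diagram_def diagonal_rows_def)

lemma sorted_diagonal_rows: "sorted_wrt (\<ge>) (diagonal_rows r s n)"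
  by (auto simp: diagonal_rows_def sorted_wrt_map sorted_wrt_iff_nth_less intro!: div_le_mono)

text \<open>A zero row contributes a single Y, and since the rows decrease all these Y stand at the
  end of the word.\<close>

lemma diagram_word_filter:
  "sorted_wrt (\<ge>) l \<Longrightarrow> \<exists>z. diagram_word l = diagram_word (filter (\<lambda>k. k > 0) l) @ replicate z LY"
proof (induction l rule: diagram_word.induct)
  case (2 a)
  show ?case
  proof (cases "a = 0")
    case True
    then show ?thesis by (auto intro!: exI[of _ 1])
  qed (auto intro!: exI[of _ 0])
next
  case (3 a b l)
  then obtain z where z: "diagram_word (b # l) = diagram_word (filter (\<lambda>k. k > 0) (b # l)) @ replicate z LY"
    by auto
  show ?case
  proof (cases "b = 0")
    case True
    with 3 have 0: "filter (\<lambda>k. k > 0) (b # l) = []" by (auto simp: filter_empty_conv)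
    show ?thesis
    proof (cases "a = 0")
      case True
      then show ?thesis using 0 z \<open>b = 0\<close> by (auto intro!: exI[of _ "Suc z"])
    next
      case False
      then show ?thesis using 0 z \<open>b = 0\<close> by (auto intro!: exI[of _ z])
    qed
  next
    case False
    with 3 have "a > 0" by auto
    with False z show ?thesis by (auto intro!: exI[of _ z])
  qed
qed simp

text \<open>The path starts at (1, 0) rather than at the origin because the final X of the cutting
  word, the extra X_m in the coinvariant of the diagram, has already been passed. After the Y
  counted by n + 1, the abscissa is one more than the floor of r n / s.\<close>

lemma diagram_word_diagonal_rows:
  assumes "s > 0"
  shows "cutting_path r s 1 0 (rev (diagram_word (diagonal_rows r s (Suc n)))) \<and>
    count_list (diagram_word (diagonal_rows r s (Suc n))) LX = r * n div s \<and>
    count_list (diagram_word (diagonal_rows r s (Suc n))) LY = Suc n"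
proof (induction n)
  case 0
  show ?case using assms by (simp add: diagonal_rows_Suc) (simp add: diagonal_rows_def)
next
  case (Suc n)
  let ?f = "\<lambda>n. r * n div s"
  let ?D = "diagram_word (diagonal_rows r s (Suc n))"
  have D: "diagram_word (diagonal_rows r s (Suc (Suc n))) = LY # replicate (?f (Suc n) - ?f n) LX @ ?D"
    by (simp only: diagonal_rows_Suc diagram_word.simps)
  have f: "?f n \<le> ?f (Suc n)" by (intro div_le_mono) simp
  have "s * (1 + ?f n + (?f (Suc n) - ?f n)) \<le> r * Suc n + s"
    using f by (simp add: algebra_simps)
  then have "cutting_path r s (1 + ?f n) (Suc n) (replicate (?f (Suc n) - ?f n) LX)"
    by (rule cutting_path_replicate_LX)
  \<comment> \<open>The defining property of the floor: the run of X ends strictly beyond the line,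
    so the letter dictated next is the Y of the new row.\<close>
  moreover have "r * Suc n < s * (1 + ?f (Suc n))"
    using assms dividend_less_div_times[of s "r * Suc n"] by (simp add: algebra_simps)
  ultimately have "cutting_path r s 1 0 (rev (diagram_word (diagonal_rows r s (Suc (Suc n)))))"
    using Suc.IH f unfolding D by (simp add: cutting_path_append)
  then show ?case using Suc.IH f unfolding D by simp
qed

lemma torus_word_even_cf:
  assumes "r > 0" "s > 0" "coprime r s"
  shows "\<exists>p z. torus_word (even_cf r s) =
    replicate p LX @ diagram_word (torus_diagram r s) @ replicate z LY @ [LX]"
proof -
  obtain n where n: "s = Suc n" using assms by (cases s) auto
  let ?D = "diagram_word (diagonal_rows r s s)"
  \<comment> \<open>What is missing from r letters X after the final one and those of the diagram.
    The path has then already reached height s, where X is allowed up to abscissa r.\<close>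
  define p where "p = r - 1 - r * n div s"
  have "r * n div s < r" using assms by (simp add: div_less_iff_less_mult n)
  then have p: "1 + r * n div s + p = r" by (simp add: p_def)
  have "cutting_path r s (1 + r * n div s) s (replicate p LX)"
    using p by (intro cutting_path_replicate_LX) (simp add: mult.commute)
  then have "is_cutting_word r s (replicate p LX @ ?D @ [LX])"
    using diagram_word_diagonal_rows[OF assms(2), of r n] p
    by (simp add: is_cutting_word_def cutting_path_append n)
  then have "torus_word (even_cf r s) = replicate p LX @ ?D @ [LX]"
    using is_cutting_word_torus_word[OF assms] is_cutting_word_unique by blast
  then show ?thesis
    using diagram_word_filter[OF sorted_diagonal_rows, of r s s] by (auto simp: torus_diagram_eq)
qed

section \<open>Root systems and Weyl groups\<close>

lemma smult_vec_apply: "(c *\<^sub>v v) i = c * v i"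
  by (simp add: smult_vec_def)

lemma sum_fun_apply: "(\<Sum>a\<in>A. f a) x = (\<Sum>a\<in>A. f a x)"
  by (induction A rule: infinite_finite_induct) simp_all

lemmas vec_simps = fun_eq_iff sum_fun_apply smult_vec_apply

lemma ip_commute: "ip D v w = ip D w v"
  by (simp add: ip_def mult.commute)

lemma ip_add_left: "ip D (u + v) w = ip D u w + ip D v w"
  by (simp add: ip_def sum.distrib algebra_simps)

lemma ip_diff_left: "ip D (u - v) w = ip D u w - ip D v w"
  by (simp add: ip_def sum_subtractf algebra_simps)

lemma ip_uminus_left: "ip D (- v) w = - ip D v w"
  by (simp add: ip_def sum_negf)

lemma ip_smult_left: "ip D (c *\<^sub>v v) w = c * ip D v w"
  by (simp add: ip_def sum_distrib_left smult_vec_apply mult.assoc)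

lemma ip_zero_left [simp]: "ip D 0 w = 0"
  by (simp add: ip_def)

lemma ip_sum_left: "ip D (\<Sum>a\<in>A. f a) w = (\<Sum>a\<in>A. ip D (f a) w)"
  unfolding ip_def sum_fun_apply sum_distrib_right by (rule sum.swap)

lemmas ip_left_simps = ip_add_left ip_diff_left ip_uminus_left ip_smult_left ip_sum_left

lemma ip_right_simps:
  "ip D w (u + v) = ip D w u + ip D w v"
  "ip D w (u - v) = ip D w u - ip D w v"
  "ip D w (- v) = - ip D w v"
  "ip D w (c *\<^sub>v v) = c * ip D w v"
  "ip D w 0 = 0"
  "ip D w (\<Sum>a\<in>A. f a) = (\<Sum>a\<in>A. ip D w (f a))"
  by (simp_all add: ip_commute[of D w] ip_left_simps)

lemma copair_left_simps:
  "copair D (u + v) a = copair D u a + copair D v a"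
  "copair D (u - v) a = copair D u a - copair D v a"
  "copair D (- v) a = - copair D v a"
  "copair D (c *\<^sub>v v) a = c * copair D v a"
  "copair D 0 a = 0"
  "copair D (\<Sum>x\<in>A. f x) a = (\<Sum>x\<in>A. copair D (f x) a)"
  by (simp_all add: copair_def ip_left_simps add_divide_distrib diff_divide_distrib
      distrib_left right_diff_distrib sum_distrib_left sum_divide_distrib)

lemma copair_uminus_right: "copair D v (- a) = - copair D v a"
  by (simp add: copair_def ip_left_simps ip_right_simps)

lemma ip_self_nonneg: "ip D v v \<ge> 0"
  by (simp add: ip_def sum_nonneg)

text \<open>Coordinates from \<open>dimn D\<close> on are invisible to the inner product, which is
  definite only on vectors supported below.\<close>

lemma ip_self_eq_0D:
  assumes "ip D v v = 0" "\<forall>i\<ge>dimn D. v i = 0"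
  shows "v = 0"
proof
  fix i
  have "\<forall>i\<in>{..<dimn D}. v i * v i = 0"
    using assms(1) unfolding ip_def by (subst (asm) sum_nonneg_eq_0_iff) simp_all
  with assms(2) show "v i = 0 i" by (cases "i < dimn D") simp_all
qed

lemma refl_vec_simps:
  "refl_vec D a (u + v) = refl_vec D a u + refl_vec D a v"
  "refl_vec D a (u - v) = refl_vec D a u - refl_vec D a v"
  "refl_vec D a (- v) = - refl_vec D a v"
  "refl_vec D a 0 = 0"
  by (auto simp: refl_vec_def copair_left_simps algebra_simps vec_simps)

lemma refl_vec_smult: "refl_vec D a (c *\<^sub>v v) = c *\<^sub>v refl_vec D a v"
  by (simp only: refl_vec_def copair_left_simps) (simp add: vec_simps algebra_simps)

lemma weyl_word_Nil [simp]: "weyl_word D [] = id"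
  by (simp add: weyl_word_def)

lemma weyl_word_Cons [simp]: "weyl_word D (i # js) v = refl_vec D (sroot D i) (weyl_word D js v)"
  by (simp add: weyl_word_def)

lemma weyl_word_append: "weyl_word D (is @ js) v = weyl_word D is (weyl_word D js v)"
  by (induction "is") simp_all

lemma weyl_word_linear:
  "weyl_word D js (u + v) = weyl_word D js u + weyl_word D js v"
  "weyl_word D js (u - v) = weyl_word D js u - weyl_word D js v"
  "weyl_word D js (- v) = - weyl_word D js v"
  "weyl_word D js 0 = 0"
  by (induction js) (simp_all add: refl_vec_simps)

lemma weyl_lengthE:
  assumes "w \<in> weyl D"
  obtains "is" where "set is \<subseteq> {1..rnk D}" "weyl_word D is = w" "length is = weyl_length D w"
proof -
  have "\<exists>l. \<exists>is. set is \<subseteq> {1..rnk D} \<and> weyl_word D is = w \<and> length is = l"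
    using assms by (auto simp: weyl_def)
  from LeastI_ex[OF this] show ?thesis using that by (auto simp: weyl_length_def)
qed

lemma weyl_length_le: "set js \<subseteq> {1..rnk D} \<Longrightarrow> weyl_length D (weyl_word D js) \<le> length js"
  unfolding weyl_length_def by (rule Least_le) blast

lemma id_in_weyl: "id \<in> weyl D"
  unfolding weyl_def by (rule CollectI, rule exI[of _ "[]"]) simp

text \<open>These axioms are common to all the systems that occur. The system
  \<open>type_A 1\<close>, which enters for m = 1, has no roots, hence is neither irreducible nor
  normalized in the sense of the definitions.\<close>

locale root_datum =
  fixes D :: root_sys
  assumes reduced: "reduced_root_system D"
    and simple_roots: "simple_roots_of D"
    and fundamental_weights: "fundamental_weights_of D"
begin

lemma finite_roots: "finite (roots D)"
  and root_nonzero: "a \<in> roots D \<Longrightarrow> a \<noteq> 0"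
  and root_support: "a \<in> roots D \<Longrightarrow> i \<ge> dimn D \<Longrightarrow> a i = 0"
  and refl_root: "a \<in> roots D \<Longrightarrow> b \<in> roots D \<Longrightarrow> refl_vec D a b \<in> roots D"
  and copair_root_Ints: "a \<in> roots D \<Longrightarrow> b \<in> roots D \<Longrightarrow> copair D b a \<in> \<int>"
  and smult_root: "a \<in> roots D \<Longrightarrow> c *\<^sub>v a \<in> roots D \<Longrightarrow> c = 1 \<or> c = -1"
  using reduced by (auto simp: reduced_root_system_def)

lemma sroot_root: "i \<in> {1..rnk D} \<Longrightarrow> sroot D i \<in> roots D"
  and sroot_independent:
    "(\<Sum>i=1..rnk D. c i *\<^sub>v sroot D i) = 0 \<Longrightarrow> i \<in> {1..rnk D} \<Longrightarrow> c i = 0"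
  and root_pos_or_neg: "a \<in> roots D \<Longrightarrow> a \<in> pos_roots D \<or> - a \<in> pos_roots D"
  using simple_roots unfolding simple_roots_of_def by blast+

lemma ip_root_pos: "a \<in> roots D \<Longrightarrow> ip D a a > 0"
  using ip_self_nonneg[of D a] ip_self_eq_0D[of D a] root_nonzero[of a] root_support[of a] by force

lemma copair_self: "a \<in> roots D \<Longrightarrow> copair D a a = 2"
  using ip_root_pos[of a] by (simp add: copair_def)

lemma refl_vec_involution: "a \<in> roots D \<Longrightarrow> refl_vec D a (refl_vec D a v) = v"
  by (auto simp: refl_vec_def copair_left_simps copair_self vec_simps)

lemma ip_refl_vec:
  assumes "a \<in> roots D"
  shows "ip D (refl_vec D a u) (refl_vec D a v) = ip D u v"
proof -
  have half: "ip D w a = copair D w a * ip D a a / 2" for w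
    using ip_root_pos[OF assms] by (simp add: copair_def)
  have "ip D (refl_vec D a u) (refl_vec D a v) = ip D u v - copair D v a * ip D u a
      - copair D u a * ip D v a + copair D u a * copair D v a * ip D a a"
    by (simp add: refl_vec_def ip_left_simps ip_right_simps ip_commute[of D a v] algebra_simps)
  then show ?thesis by (simp add: half[of u] half[of v])
qed

lemma weyl_word_inverse: "set js \<subseteq> {1..rnk D} \<Longrightarrow> weyl_word D js (weyl_word D (rev js) v) = v"
  by (induction js arbitrary: v) (simp_all add: weyl_word_append refl_vec_involution sroot_root)

lemma weyl_word_inverse': "set js \<subseteq> {1..rnk D} \<Longrightarrow> weyl_word D (rev js) (weyl_word D js v) = v"
  using weyl_word_inverse[of "rev js"] by simp

lemma bij_weyl_word: "set js \<subseteq> {1..rnk D} \<Longrightarrow> bij (weyl_word D js)"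
  by (rule o_bij[of "weyl_word D (rev js)"])
    (simp_all add: vec_simps weyl_word_inverse weyl_word_inverse')

lemma inv_weyl_word: "set js \<subseteq> {1..rnk D} \<Longrightarrow> inv (weyl_word D js) = weyl_word D (rev js)"
  by (rule inv_unique_comp) (simp_all add: vec_simps weyl_word_inverse weyl_word_inverse')

lemma ip_weyl_word:
  "set js \<subseteq> {1..rnk D} \<Longrightarrow> ip D (weyl_word D js u) (weyl_word D js v) = ip D u v"
  by (induction js) (simp_all add: ip_refl_vec sroot_root)

lemma copair_weyl_word:
  "set js \<subseteq> {1..rnk D} \<Longrightarrow> copair D (weyl_word D js u) (weyl_word D js v) = copair D u v"
  by (simp add: copair_def ip_weyl_word)

lemma weyl_word_root: "set js \<subseteq> {1..rnk D} \<Longrightarrow> a \<in> roots D \<Longrightarrow> weyl_word D js a \<in> roots D"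
  by (induction js) (simp_all add: refl_root sroot_root)

lemma weyl_word_image_roots:
  assumes "set js \<subseteq> {1..rnk D}"
  shows "weyl_word D js ` roots D = roots D"
proof
  show "weyl_word D js ` roots D \<subseteq> roots D" using assms weyl_word_root by auto
  show "roots D \<subseteq> weyl_word D js ` roots D"
  proof
    fix a assume "a \<in> roots D"
    then have "weyl_word D (rev js) a \<in> roots D" using assms by (intro weyl_word_root) simp_all
    then have "weyl_word D js (weyl_word D (rev js) a) \<in> weyl_word D js ` roots D" by (rule imageI)
    then show "a \<in> weyl_word D js ` roots D" using assms by (simp add: weyl_word_inverse)
  qed
qed

lemma refl_vec_weyl_word:
  "set js \<subseteq> {1..rnk D} \<Longrightarrow>
    refl_vec D (weyl_word D js a) (weyl_word D js v) = weyl_word D js (refl_vec D a v)"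
proof -
  assume "set js \<subseteq> {1..rnk D}"
  moreover have "weyl_word D js (c *\<^sub>v v) = c *\<^sub>v weyl_word D js v" for c v
    by (induction js) (simp_all add: refl_vec_smult)
  ultimately show ?thesis by (simp add: refl_vec_def copair_weyl_word weyl_word_linear)
qed

lemma weyl_word_diff_simple_span:
  "set js \<subseteq> {1..rnk D} \<Longrightarrow> \<exists>c. v - weyl_word D js v = (\<Sum>i=1..rnk D. c i *\<^sub>v sroot D i)"
proof (induction js)
  case Nil
  show ?case by (intro exI[of _ "\<lambda>_. 0"]) (auto simp: vec_simps)
next
  case (Cons j js)
  from Cons.prems have "set js \<subseteq> {1..rnk D}" by simp
  then obtain c where c: "v - weyl_word D js v = (\<Sum>i=1..rnk D. c i *\<^sub>v sroot D i)"
    using Cons.IH by blast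
  define k where "k = copair D (weyl_word D js v) (sroot D j)"
  have "v - weyl_word D (j # js) v = (v - weyl_word D js v) + k *\<^sub>v sroot D j"
    by (simp add: refl_vec_def k_def)
  also have "k *\<^sub>v sroot D j = (\<Sum>i=1..rnk D. (if i = j then k else 0) *\<^sub>v sroot D i)"
    using Cons.prems by (auto simp: vec_simps if_distrib[of "\<lambda>x. x * _"] sum.delta cong: if_cong)
  also have "(v - weyl_word D js v) + \<dots> = (\<Sum>i=1..rnk D. (c i + (if i = j then k else 0)) *\<^sub>v sroot D i)"
    by (simp only: c flip: sum.distrib) (auto simp: vec_simps algebra_simps intro!: sum.cong)
  finally show ?case by (intro exI)
qed

lemma simple_span_orthogonal_eq_0:
  assumes "v \<in> simple_span D" "\<And>i. i \<in> {1..rnk D} \<Longrightarrow> ip D v (sroot D i) = 0"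
  shows "v = 0"
proof -
  obtain c where c: "v = (\<Sum>i=1..rnk D. c i *\<^sub>v sroot D i)" using assms(1) by (auto simp: simple_span_def)
  have "ip D v v = (\<Sum>i=1..rnk D. c i * ip D v (sroot D i))"
    by (subst (2) c) (simp add: ip_right_simps)
  also have "\<dots> = 0" using assms(2) by simp
  finally show ?thesis
    by (rule ip_self_eq_0D) (auto simp: c vec_simps root_support sroot_root intro!: sum.neutral)
qed

lemma simple_span_diff: "u \<in> simple_span D \<Longrightarrow> v \<in> simple_span D \<Longrightarrow> u - v \<in> simple_span D"
proof -
  assume "u \<in> simple_span D" "v \<in> simple_span D"
  then obtain c d where "u = (\<Sum>i=1..rnk D. c i *\<^sub>v sroot D i)" "v = (\<Sum>i=1..rnk D. d i *\<^sub>v sroot D i)"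
    by (auto simp: simple_span_def)
  then have "u - v = (\<Sum>i=1..rnk D. (c i - d i) *\<^sub>v sroot D i)"
    by (simp flip: sum_subtractf) (auto simp: vec_simps algebra_simps)
  then show ?thesis by (auto simp: simple_span_def)
qed

lemma simple_span_smult: "v \<in> simple_span D \<Longrightarrow> k *\<^sub>v v \<in> simple_span D"
proof -
  assume "v \<in> simple_span D"
  then obtain c where "v = (\<Sum>i=1..rnk D. c i *\<^sub>v sroot D i)" by (auto simp: simple_span_def)
  then have "k *\<^sub>v v = (\<Sum>i=1..rnk D. (k * c i) *\<^sub>v sroot D i)"
    by (auto simp: vec_simps sum_distrib_left algebra_simps)
  then show ?thesis by (auto simp: simple_span_def)
qed

lemma simple_span_zero: "0 \<in> simple_span D"
  by (auto simp: simple_span_def vec_simps intro!: exI[of _ "\<lambda>_. 0"])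

lemma simple_span_sum: "(\<And>x. x \<in> A \<Longrightarrow> f x \<in> simple_span D) \<Longrightarrow> (\<Sum>x\<in>A. f x) \<in> simple_span D"
proof (induction A rule: infinite_finite_induct)
  case (insert x A)
  have "f x - (0 - (\<Sum>x\<in>A. f x)) \<in> simple_span D"
    by (intro simple_span_diff simple_span_zero insert) (use insert in auto)
  then show ?case unfolding sum.insert[OF insert.hyps] by (simp only: diff_0 diff_minus_eq_add)
qed (simp_all add: simple_span_zero)

lemma sroot_simple_span: "i \<in> {1..rnk D} \<Longrightarrow> sroot D i \<in> simple_span D"
  by (auto simp: simple_span_def vec_simps if_distrib[of "\<lambda>x. x * _"] sum.delta
      cong: if_cong intro!: exI[of _ "\<lambda>j. if j = i then 1 else 0"])

text \<open>The permutation of the roots determines a Weyl group element on the whole ambient space,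
  since it fixes the orthogonal complement of the span of the roots.\<close>

lemma finite_weyl: "finite (weyl D)"
proof -
  have "inj_on (\<lambda>w. restrict w (roots D)) (weyl D)"
  proof (rule inj_onI)
    fix w w' assume "w \<in> weyl D" "w' \<in> weyl D" and eq: "restrict w (roots D) = restrict w' (roots D)"
    then obtain js ks where w: "w = weyl_word D js" "set js \<subseteq> {1..rnk D}"
      and w': "w' = weyl_word D ks" "set ks \<subseteq> {1..rnk D}" by (auto simp: weyl_def)
    show "w = w'"
    proof
      fix v
      have span: "v - weyl_word D is v \<in> simple_span D" if "set is \<subseteq> {1..rnk D}" for "is"
        using weyl_word_diff_simple_span[OF that, of v] unfolding simple_span_def by blast
      have "(v - w v) - (v - w' v) = 0"
      proof (rule simple_span_orthogonal_eq_0)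
        show "(v - w v) - (v - w' v) \<in> simple_span D"
          unfolding w w' by (intro simple_span_diff span w w')
      next
        fix i assume "i \<in> {1..rnk D}"
        then obtain a where a: "a \<in> roots D" "sroot D i = w a"
          using weyl_word_image_roots[OF w(2)] sroot_root w by blast
        with eq have a': "sroot D i = w' a" by (metis restrict_apply')
        have "ip D (w v) (sroot D i) = ip D v a" using w by (simp add: a ip_weyl_word)
        moreover have "ip D (w' v) (sroot D i) = ip D v a" using w' by (simp add: a' ip_weyl_word)
        ultimately show "ip D ((v - w v) - (v - w' v)) (sroot D i) = 0" by (simp add: ip_left_simps)
      qed
      then show "w v = w' v" by simp
    qed
  qed
  moreover have "(\<lambda>w. restrict w (roots D)) ` weyl D \<subseteq> roots D \<rightarrow>\<^sub>E roots D"
    by (auto simp: weyl_def weyl_word_root)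
  ultimately show ?thesis
    using finite_roots by (meson inj_on_finite finite_PiE)
qed

text \<open>\<open>ARG_MAX\<close> has a value only when the length is bounded on the Weyl group;
  this is the purpose of \<open>finite_weyl\<close>.\<close>

lemma longest_in_weyl: "longest D \<in> weyl D"
proof -
  have "\<forall>w. w \<in> weyl D \<longrightarrow> weyl_length D w < Suc (Max (weyl_length D ` weyl D))"
    using finite_weyl by (auto simp: less_Suc_eq_le)
  then show ?thesis
    unfolding longest_def by (rule arg_max_natI[of "\<lambda>w. w \<in> weyl D", OF id_in_weyl])
qed

lemma u_elt_in_weyl: "u_elt D m \<in> weyl D"
  and u_elt_fweight: "u_elt D m (fweight D m) = longest D (fweight D m)"
  and u_elt_minimal: "w \<in> weyl D \<Longrightarrow> w (fweight D m) = longest D (fweight D m) \<Longrightarrow>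
    weyl_length D (u_elt D m) \<le> weyl_length D w"
proof -
  let ?Q = "\<lambda>u. u \<in> weyl D \<and> u (fweight D m) = longest D (fweight D m)"
  have "?Q (longest D)" using longest_in_weyl by simp
  from arg_min_natI[of ?Q, OF this] show "u_elt D m \<in> weyl D"
    "u_elt D m (fweight D m) = longest D (fweight D m)"
    by (simp_all add: u_elt_def)
  show "w \<in> weyl D \<Longrightarrow> w (fweight D m) = longest D (fweight D m) \<Longrightarrow>
      weyl_length D (u_elt D m) \<le> weyl_length D w"
    unfolding u_elt_def using arg_min_nat_le[of ?Q w] by simp
qed

text \<open>The reflection changes only the coefficient of the i-th simple root. If the image were
  negative, every other coefficient of a would be both nonnegative and nonpositive, so a would be a
  multiple of that simple root, and the system is reduced.\<close>

lemma refl_pos_root: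
  assumes "a \<in> pos_roots D" "i \<in> {1..rnk D}" "a \<noteq> sroot D i"
  shows "refl_vec D (sroot D i) a \<in> pos_roots D"
proof (rule ccontr)
  assume "refl_vec D (sroot D i) a \<notin> pos_roots D"
  moreover have root: "a \<in> roots D" using assms(1) by (simp add: pos_roots_def)
  ultimately have neg: "- refl_vec D (sroot D i) a \<in> pos_roots D"
    using root_pos_or_neg refl_root sroot_root assms(2) by blast
  define c where "c = copair D a (sroot D i)"
  obtain k where k: "a = (\<Sum>j=1..rnk D. real (k j) *\<^sub>v sroot D j)"
    using assms(1) by (auto simp: pos_roots_def)
  obtain l where l: "- refl_vec D (sroot D i) a = (\<Sum>j=1..rnk D. real (l j) *\<^sub>v sroot D j)"
    using neg by (auto simp: pos_roots_def)
  have "(\<Sum>j=1..rnk D. (real (k j) + real (l j) - (if j = i then c else 0)) *\<^sub>v sroot D j)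
      = (\<Sum>j=1..rnk D. real (k j) *\<^sub>v sroot D j) + (\<Sum>j=1..rnk D. real (l j) *\<^sub>v sroot D j)
        - c *\<^sub>v sroot D i"
    using assms(2)
    by (auto simp: vec_simps algebra_simps sum.distrib sum_subtractf
        if_distrib[of "\<lambda>x. _ * x"] sum.delta cong: if_cong)
  also have "\<dots> = a - refl_vec D (sroot D i) a - c *\<^sub>v sroot D i" by (simp only: diff_conv_add_uminus flip: k l)
  also have "\<dots> = 0" by (simp add: refl_vec_def c_def)
  finally have zero: "real (k j) + real (l j) - (if j = i then c else 0) = 0" if "j \<in> {1..rnk D}" for j
    using that by (rule sroot_independent[where c = "\<lambda>j. real (k j) + real (l j) - (if j = i then c else 0)"])
  have "a = (\<Sum>j=1..rnk D. (if j = i then real (k i) else 0) *\<^sub>v sroot D j)"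
  proof -
    have "k j = 0" if "j \<in> {1..rnk D}" "j \<noteq> i" for j
      using zero[OF that(1)] that(2) by simp
    then show ?thesis unfolding k by (intro sum.cong) auto
  qed
  also have "\<dots> = real (k i) *\<^sub>v sroot D i"
    using assms(2) by (auto simp: vec_simps if_distrib[of "\<lambda>x. x * _"] sum.delta cong: if_cong)
  finally have a: "a = real (k i) *\<^sub>v sroot D i" .
  with smult_root[OF sroot_root[OF assms(2)], of "real (k i)"] root have "real (k i) = 1" by auto
  with a assms(3) show False by (auto simp: vec_simps)
qed

text \<open>Peel letters off from the left as long as the image of b stays positive. By
  \<open>refl_pos_root\<close> positivity is lost only at a letter whose simple root is the current
  image, and it has to be lost because b itself is not positive.\<close>

lemma exchange:
  assumes "set js \<subseteq> {1..rnk D}" "b \<notin> pos_roots D" "weyl_word D js b \<in> pos_roots D"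
  shows "\<exists>js1 j js2. js = js1 @ j # js2 \<and> weyl_word D js b = weyl_word D js1 (sroot D j)"
  using assms
proof (induction js)
  case (Cons j js)
  show ?case
  proof (cases "weyl_word D (j # js) b = sroot D j")
    case True
    then show ?thesis by (intro exI[of _ "[]"]) simp
  next
    case False
    have "refl_vec D (sroot D j) (weyl_word D (j # js) b) \<in> pos_roots D"
      using Cons.prems False by (intro refl_pos_root) auto
    then have "weyl_word D js b \<in> pos_roots D"
      using Cons.prems by (simp add: refl_vec_involution sroot_root)
    then obtain js1 i js2 where "js = js1 @ i # js2" "weyl_word D js b = weyl_word D js1 (sroot D i)"
      using Cons by auto
    then show ?thesis by (intro exI[of _ "j # js1"]) simp
  qed
qed simp

section \<open>Fundamental weights and the weight lattice\<close>

lemma fweight_simple_span: "i \<in> {1..rnk D} \<Longrightarrow> fweight D i \<in> simple_span D"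
  and copair_fweight_sroot: "i \<in> {1..rnk D} \<Longrightarrow> j \<in> {1..rnk D} \<Longrightarrow>
    copair D (fweight D i) (sroot D j) = (if i = j then 1 else 0)"
  using fundamental_weights by (auto simp: fundamental_weights_of_def)

text \<open>The pairings with the simple coroots are the coordinates with respect to the fundamental
  weights. In this form it is plain that the lattice contains the simple roots and is stable under
  their reflections.\<close>

lemma weight_lattice_iff:
  "b \<in> weight_lattice D \<longleftrightarrow>
    b \<in> simple_span D \<and> (\<forall>i\<in>{1..rnk D}. copair D b (sroot D i) \<in> \<int>)"
proof
  have copair: "copair D (\<Sum>i=1..rnk D. k i *\<^sub>v fweight D i) (sroot D j) = k j"
    if "j \<in> {1..rnk D}" for k j
    using that by (simp add: copair_left_simps copair_fweight_sroot if_distrib[of "\<lambda>x. _ * x"] sum.delta cong: if_cong)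
  { assume "b \<in> weight_lattice D"
    then obtain k :: "nat \<Rightarrow> int" where b: "b = (\<Sum>i=1..rnk D. of_int (k i) *\<^sub>v fweight D i)"
      by (auto simp: weight_lattice_def)
    have "copair D b (sroot D i) \<in> \<int>" if "i \<in> {1..rnk D}" for i
      unfolding b using copair[OF that, of "\<lambda>i. of_int (k i)"] by simp
    moreover have "b \<in> simple_span D"
      unfolding b by (intro simple_span_sum simple_span_smult fweight_simple_span)
    ultimately show "b \<in> simple_span D \<and> (\<forall>i\<in>{1..rnk D}. copair D b (sroot D i) \<in> \<int>)" by blast }
  { assume b: "b \<in> simple_span D \<and> (\<forall>i\<in>{1..rnk D}. copair D b (sroot D i) \<in> \<int>)"
    let ?k = "\<lambda>i. \<lfloor>copair D b (sroot D i)\<rfloor>"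
    have k: "of_int (?k i) = copair D b (sroot D i)" if "i \<in> {1..rnk D}" for i
      using b that by (auto elim: Ints_cases)
    have "b - (\<Sum>i=1..rnk D. of_int (?k i) *\<^sub>v fweight D i) = 0"
    proof (rule simple_span_orthogonal_eq_0)
      show "b - (\<Sum>i=1..rnk D. of_int (?k i) *\<^sub>v fweight D i) \<in> simple_span D"
        using b by (intro simple_span_diff simple_span_sum simple_span_smult fweight_simple_span) simp_all
    next
      fix j assume j: "j \<in> {1..rnk D}"
      then have "copair D (b - (\<Sum>i=1..rnk D. of_int (?k i) *\<^sub>v fweight D i)) (sroot D j) = 0"
        using k[OF j] copair[OF j, of "\<lambda>i. of_int (?k i)"] by (simp only: copair_left_simps(2) diff_self)
      then show "ip D (b - (\<Sum>i=1..rnk D. of_int (?k i) *\<^sub>v fweight D i)) (sroot D j) = 0"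
        using ip_root_pos[OF sroot_root[OF j]] by (simp add: copair_def)
    qed
    then show "b \<in> weight_lattice D" unfolding weight_lattice_def by auto }
qed

lemma weight_lattice_zero: "0 \<in> weight_lattice D"
  by (simp add: weight_lattice_iff simple_span_zero copair_left_simps)

lemma weight_lattice_diff:
  "b \<in> weight_lattice D \<Longrightarrow> c \<in> weight_lattice D \<Longrightarrow> b - c \<in> weight_lattice D"
  by (simp add: weight_lattice_iff simple_span_diff copair_left_simps)

lemma weight_lattice_uminus: "b \<in> weight_lattice D \<Longrightarrow> - b \<in> weight_lattice D"
  using weight_lattice_diff[OF weight_lattice_zero] by simp

lemma weight_lattice_add:
  "b \<in> weight_lattice D \<Longrightarrow> c \<in> weight_lattice D \<Longrightarrow> b + c \<in> weight_lattice D"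
  using weight_lattice_diff[OF _ weight_lattice_uminus] by simp

lemma weight_lattice_smult:
  "b \<in> weight_lattice D \<Longrightarrow> k \<in> \<int> \<Longrightarrow> k *\<^sub>v b \<in> weight_lattice D"
  by (simp add: weight_lattice_iff simple_span_smult copair_left_simps)

lemma sroot_weight_lattice: "i \<in> {1..rnk D} \<Longrightarrow> sroot D i \<in> weight_lattice D"
  by (simp add: weight_lattice_iff sroot_simple_span copair_root_Ints sroot_root)

lemma fweight_weight_lattice: "i \<in> {1..rnk D} \<Longrightarrow> fweight D i \<in> weight_lattice D"
  by (simp add: weight_lattice_iff fweight_simple_span copair_fweight_sroot)

lemma copair_weight_Ints:
  "b \<in> weight_lattice D \<Longrightarrow> i \<in> {1..rnk D} \<Longrightarrow> copair D b (sroot D i) \<in> \<int>"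
  by (simp add: weight_lattice_iff)

lemma refl_weight_lattice:
  "b \<in> weight_lattice D \<Longrightarrow> i \<in> {1..rnk D} \<Longrightarrow> refl_vec D (sroot D i) b \<in> weight_lattice D"
  unfolding refl_vec_def
  by (intro weight_lattice_diff weight_lattice_smult sroot_weight_lattice copair_weight_Ints)

lemma weyl_word_weight_lattice:
  "set js \<subseteq> {1..rnk D} \<Longrightarrow> b \<in> weight_lattice D \<Longrightarrow> weyl_word D js b \<in> weight_lattice D"
  by (induction js) (simp_all add: refl_weight_lattice)

end

locale minuscule_datum = root_datum +
  fixes m :: nat
  assumes m_range: "m \<in> {1..rnk D}" and minuscule: "minuscule D m"
begin

text \<open>By invariance the pairing is that of \<omega>_m with some root, which is bounded by 1 in
  absolute value since \<omega>_m is minuscule; it is also an integer.\<close>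

lemma copair_orbit:
  assumes "set js \<subseteq> {1..rnk D}" "i \<in> {1..rnk D}"
  shows "copair D (weyl_word D js (fweight D m)) (sroot D i) \<in> {-1, 0, 1}"
proof -
  let ?k = "copair D (weyl_word D js (fweight D m)) (sroot D i)"
  let ?b = "weyl_word D (rev js) (sroot D i)"
  have b: "?b \<in> roots D" using assms by (intro weyl_word_root sroot_root) simp_all
  have k: "?k = copair D (fweight D m) ?b"
    using assms copair_weyl_word[of js "fweight D m" ?b] by (simp add: weyl_word_inverse)
  have "\<bar>?k\<bar> \<le> 1"
    using root_pos_or_neg[OF b] minuscule unfolding k minuscule_def
    by (force simp: copair_uminus_right)
  moreover have "?k \<in> \<int>"
    using assms m_range
    by (intro copair_weight_Ints weyl_word_weight_lattice fweight_weight_lattice)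
  ultimately show ?thesis by (auto elim!: Ints_cases)
qed

text \<open>If a step of a word leading from \<open>\<omega>\<^sub>m\<close> to a given weight is not downward, then deleting that
  letter (if the step is constant), or that letter and an earlier one (by the exchange property),
  gives a shorter such word.\<close>

lemma copair_minimal_word:
  assumes "set (ks @ i # js) \<subseteq> {1..rnk D}"
    and minimal: "\<And>is. set is \<subseteq> {1..rnk D} \<Longrightarrow>
      weyl_word D is (fweight D m) = weyl_word D (ks @ i # js) (fweight D m) \<Longrightarrow>
      length (ks @ i # js) \<le> length is"
  shows "copair D (weyl_word D js (fweight D m)) (sroot D i) = 1"
proof -
  let ?b = "weyl_word D js (fweight D m)"
  have js: "set js \<subseteq> {1..rnk D}" and i: "i \<in> {1..rnk D}" using assms(1) by auto
  consider "copair D ?b (sroot D i) = 1" | "copair D ?b (sroot D i) = 0"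
    | "copair D ?b (sroot D i) = -1"
    using copair_orbit[OF js i] by auto
  then show ?thesis
  proof cases
    case 2
    then have "refl_vec D (sroot D i) ?b = ?b" by (auto simp: refl_vec_def vec_simps)
    then have "weyl_word D (ks @ js) (fweight D m) = weyl_word D (ks @ i # js) (fweight D m)"
      by (simp add: weyl_word_append)
    with minimal[of "ks @ js"] assms(1) show ?thesis by simp
  next
    case 3
    \<comment> \<open>The preimage of the simple root under \<open>js\<close>. It pairs to -1 with
      the minuscule weight, so it is not positive, while \<open>js\<close> makes it positive: the
      situation of \<open>exchange\<close>.\<close>
    let ?a = "weyl_word D (rev js) (sroot D i)"
    have a: "weyl_word D js ?a = sroot D i" using js by (simp add: weyl_word_inverse)
    have "copair D (fweight D m) ?a = -1"
      using 3 js copair_weyl_word[of js "fweight D m" ?a] by (simp add: weyl_word_inverse)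
    then have "?a \<notin> pos_roots D" using minuscule by (auto simp: minuscule_def)
    moreover have "sroot D i \<in> pos_roots D"
      using i sroot_root[OF i] by (auto simp: pos_roots_def vec_simps
          if_distrib[of real] if_distrib[of "\<lambda>x. x * _"] sum.delta cong: if_cong
          intro!: exI[of _ "\<lambda>j. if j = i then 1 else 0"])
    ultimately obtain js1 j js2 where js12: "js = js1 @ j # js2"
      and j: "sroot D i = weyl_word D js1 (sroot D j)"
      using exchange[OF js, of ?a] a by auto
    have "set js1 \<subseteq> {1..rnk D}" "j \<in> {1..rnk D}" using js js12 by auto
    \<comment> \<open>If w_1 denotes the action of \<open>js1\<close>, then s_i = w_1 s_j w_1^(-1),
      hence s_i w_1 s_j = w_1 and two letters disappear.\<close>
    then have "weyl_word D (i # js) v = weyl_word D (js1 @ js2) v" for v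
      by (simp add: js12 weyl_word_append j refl_vec_weyl_word refl_vec_involution sroot_root)
    then have "weyl_word D (ks @ js1 @ js2) (fweight D m) = weyl_word D (ks @ i # js) (fweight D m)"
      by (simp add: weyl_word_append)
    with minimal[of "ks @ js1 @ js2"] assms(1) js12 show ?thesis by simp
  qed
qed

end

section \<open>Operators on Laurent polynomials\<close>

lemma qt_monom_mult: "qt_monom d * qt_monom e = qt_monom (d + e)"
  by (simp add: qt_monom_def mult_single)

lemma qt_monom_zero: "qt_monom 0 = 1"
  by (simp add: qt_monom_def)

definition is_qt_monom :: "qt \<Rightarrow> bool"
  where "is_qt_monom c \<longleftrightarrow> (\<exists>e. c = qt_monom e)"

lemma is_qt_monom_intros [intro, simp]:
  "is_qt_monom (qt_monom e)" "is_qt_monom 1" "is_qt_monom (q_pow x)" "is_qt_monom (t_pow \<nu> x)"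
  "is_qt_monom (eval_X D b)"
  "is_qt_monom c \<Longrightarrow> is_qt_monom d \<Longrightarrow> is_qt_monom (c * d)"
  unfolding is_qt_monom_def q_pow_def t_pow_def eval_X_def
  by (blast intro: qt_monom_mult qt_monom_zero[symmetric])+

lemma is_hat_qt_monom_mult:
  assumes "is_hat f h" shows "is_hat (qt_monom e * f) h"
proof -
  obtain c d e' where "c \<noteq> 0" "d \<noteq> 0" and eq: "of_int c * f = of_int d * qt_monom e' * h"
    using assms by (auto simp: is_hat_def)
  have "of_int c * (qt_monom e * f) = qt_monom e * (of_int c * f)" by (simp add: mult.left_commute)
  also have "\<dots> = of_int d * (qt_monom e * qt_monom e') * h" unfolding eq by (simp add: ac_simps)
  finally have "of_int c * (qt_monom e * f) = of_int d * qt_monom (e + e') * h"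
    by (simp add: qt_monom_mult)
  then show ?thesis using assms \<open>c \<noteq> 0\<close> \<open>d \<noteq> 0\<close> unfolding is_hat_def by blast
qed

text \<open>Only the proportionality clause of \<open>is_hat\<close> involves f, and it absorbs a
  monomial. Multiplying by the inverse monomial gives the converse, so the two predicates are equal
  and with them the option values.\<close>

lemma hat_monom_mult:
  assumes "is_qt_monom c" shows "hat (c * f) = hat f"
proof -
  obtain e where c: "c = qt_monom e" using assms by (auto simp: is_qt_monom_def)
  have "is_hat (qt_monom e * f) h \<longleftrightarrow> is_hat f h" for h
    using is_hat_qt_monom_mult[of f h e] is_hat_qt_monom_mult[of "qt_monom e * f" h "- e"]
    by (auto simp: qt_monom_mult qt_monom_zero simp flip: mult.assoc)
  then have "is_hat (qt_monom e * f) = is_hat f" by blast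
  then show ?thesis by (simp add: hat_def c)
qed

section \<open>Laurent polynomials and their evaluation\<close>

lemma lookup_smult_laurent:
  "Poly_Mapping.lookup (smult_laurent c f) b = c * Poly_Mapping.lookup f b"
  unfolding smult_laurent_def mult_map_scale_conv_mult[symmetric]
  by (simp add: Poly_Mapping.map.rep_eq when_def)

lemma smult_laurent_simps:
  "smult_laurent c (smult_laurent d f) = smult_laurent (c * d) f"
  "smult_laurent 1 f = f"
  "smult_laurent c 0 = 0"
  "smult_laurent c (f + g) = smult_laurent c f + smult_laurent c g"
  "smult_laurent c (f - g) = smult_laurent c f - smult_laurent c g"
  "smult_laurent c (- f) = - smult_laurent c f"
  "smult_laurent (c - d) f = smult_laurent c f - smult_laurent d f"
  by (simp_all add: smult_laurent_def algebra_simps mult_single single_diff flip: mult.assoc)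

lemma mult_smult_laurent: "g * smult_laurent c f = smult_laurent c (g * f)"
  by (simp add: smult_laurent_def ac_simps)

lemma smult_laurent_sum: "smult_laurent c (\<Sum>x\<in>A. f x) = (\<Sum>x\<in>A. smult_laurent c (f x))"
  by (simp add: smult_laurent_def sum_distrib_left)

lemma X_monom_mult: "X_monom a * X_monom b = X_monom (a + b)"
  by (simp add: X_monom_def mult_single)

lemma X_monom_zero: "X_monom 0 = 1"
  by (simp add: X_monom_def)

lemma lookup_X_monom: "Poly_Mapping.lookup (X_monom a) b = (if a = b then 1 else 0)"
  by (simp add: X_monom_def lookup_single when_def)

lemma lookup_X_monom_mult:
  "Poly_Mapping.lookup (X_monom a * g) b = Poly_Mapping.lookup g (b - a)"
proof -
  have "b = a + q \<longleftrightarrow> q = b - a" for q by (auto simp: algebra_simps)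
  then show ?thesis
    by (simp add: X_monom_def lookup_mult lookup_single when_mult)
qed

text \<open>If X_a g = g, the coefficients of g are constant along the infinite progression b, b -
  a, b - 2 a, ..., so they vanish by finiteness of the support. This makes the quotient described by
  \<open>quot_X\<close> unique.\<close>

lemma X_monom_minus_one_mult_eq_0:
  assumes "a \<noteq> 0" "(X_monom a - 1) * g = 0"
  shows "g = 0"
proof (rule poly_mapping_eqI)
  fix b
  have shift: "Poly_Mapping.lookup g (c - a) = Poly_Mapping.lookup g c" for c
  proof -
    have "X_monom a * g = g" using assms(2) by (simp add: algebra_simps)
    then show ?thesis by (metis lookup_X_monom_mult)
  qed
  have iter: "Poly_Mapping.lookup g (b - real n *\<^sub>v a) = Poly_Mapping.lookup g b" for n
  proof (induction n)
    case 0
    have "b - real 0 *\<^sub>v a = b" by (auto simp: vec_simps)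
    then show ?case by simp
  next
    case (Suc n)
    have "b - real (Suc n) *\<^sub>v a = b - real n *\<^sub>v a - a" by (auto simp: vec_simps algebra_simps)
    then show ?case using Suc shift by metis
  qed
  obtain i where i: "a i \<noteq> 0" using assms(1) by (auto simp: fun_eq_iff)
  have "inj (\<lambda>n. b - real n *\<^sub>v a)"
  proof (rule injI)
    fix n n' assume "b - real n *\<^sub>v a = b - real n' *\<^sub>v a"
    from fun_cong[OF this, of i] i show "n = n'" by (simp add: smult_vec_apply)
  qed
  then have "infinite (range (\<lambda>n. b - real n *\<^sub>v a))" using finite_imageD by blast
  moreover have "range (\<lambda>n. b - real n *\<^sub>v a) \<subseteq> Poly_Mapping.keys g"
    if "Poly_Mapping.lookup g b \<noteq> 0"
    using iter that by (auto simp: in_keys_iff)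
  ultimately show "Poly_Mapping.lookup g b = Poly_Mapping.lookup 0 b"
    using finite_keys[of g] finite_subset by (metis lookup_zero)
qed

lemma laurent_eq_sum:
  "f = (\<Sum>b\<in>Poly_Mapping.keys f. smult_laurent (Poly_Mapping.lookup f b) (X_monom b))"
  by (rule poly_mapping_eqI)
    (simp add: lookup_sum lookup_smult_laurent lookup_X_monom in_keys_iff if_distrib[of "\<lambda>x. _ * x"]
      sum.delta cong: if_cong)

lemma lin_ext_superset:
  assumes "finite S" "Poly_Mapping.keys f \<subseteq> S"
  shows "lin_ext \<phi> f = (\<Sum>b\<in>S. smult_laurent (Poly_Mapping.lookup f b) (\<phi> b))"
  unfolding lin_ext_def using assms
  by (intro sum.mono_neutral_left) (auto simp: in_keys_iff smult_laurent_def)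

lemma keys_smult_laurent: "Poly_Mapping.keys (smult_laurent c f) \<subseteq> Poly_Mapping.keys f"
  by (auto simp: in_keys_iff lookup_smult_laurent)

lemma lin_ext_smult: "lin_ext \<phi> (smult_laurent c f) = smult_laurent c (lin_ext \<phi> f)"
  by (subst lin_ext_superset[OF finite_keys keys_smult_laurent])
    (simp add: lin_ext_def lookup_smult_laurent smult_laurent_sum smult_laurent_simps)

lemma lin_ext_X_monom: "lin_ext \<phi> (X_monom b) = \<phi> b"
  by (simp add: lin_ext_def X_monom_def smult_laurent_simps)

lemma eval_rho_superset:
  assumes "finite S" "Poly_Mapping.keys f \<subseteq> S"
  shows "eval_rho D f = (\<Sum>b\<in>S. Poly_Mapping.lookup f b * eval_X D b)"
  unfolding eval_rho_def using assms
  by (intro sum.mono_neutral_left) (auto simp: in_keys_iff)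

lemma eval_rho_smult: "eval_rho D (smult_laurent c f) = c * eval_rho D f"
  by (subst eval_rho_superset[OF finite_keys keys_smult_laurent])
    (simp add: eval_rho_def lookup_smult_laurent sum_distrib_left mult.assoc)

lemma eval_X_add: "eval_X D (a + b) = eval_X D a * eval_X D b"
proof -
  have "(0, \<lambda>\<nu>. - ip D (rho D \<nu>) (a + b) / \<nu>)
      = (0 :: real, \<lambda>\<nu>. - ip D (rho D \<nu>) a / \<nu>) + (0, \<lambda>\<nu>. - ip D (rho D \<nu>) b / \<nu>)"
    by (auto simp: fun_eq_iff ip_right_simps diff_divide_distrib)
  then show ?thesis by (simp add: eval_X_def qt_monom_mult)
qed

lemma eval_X_zero: "eval_X D 0 = 1"
proof -
  have "(0, \<lambda>\<nu>. - ip D (rho D \<nu>) 0 / \<nu>) = (0 :: expo)"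
    by (auto simp: fun_eq_iff ip_right_simps zero_prod_def)
  then show ?thesis by (simp only: eval_X_def qt_monom_zero)
qed

text \<open>Evaluation is multiplicative; this instance removes leading letters X from a word under
  the coinvariant.\<close>

lemma eval_rho_X_monom_mult: "eval_rho D (X_monom b * f) = eval_X D b * eval_rho D f"
proof -
  have keys: "Poly_Mapping.keys (X_monom b * f) \<subseteq> (\<lambda>c. b + c) ` Poly_Mapping.keys f"
  proof
    fix c assume "c \<in> Poly_Mapping.keys (X_monom b * f)"
    then have "c - b \<in> Poly_Mapping.keys f" by (simp add: in_keys_iff lookup_X_monom_mult)
    then have "b + (c - b) \<in> (\<lambda>c. b + c) ` Poly_Mapping.keys f" by (rule imageI)
    then show "c \<in> (\<lambda>c. b + c) ` Poly_Mapping.keys f" by simp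
  qed
  have "eval_rho D (X_monom b * f)
      = (\<Sum>c\<in>Poly_Mapping.keys f. Poly_Mapping.lookup f (b + c - b) * eval_X D (b + c))"
    by (subst eval_rho_superset[OF _ keys]) (simp_all add: sum.reindex lookup_X_monom_mult)
  then show ?thesis by (simp add: eval_rho_def eval_X_add sum_distrib_left ac_simps)
qed

section \<open>Composition and scaling of operators\<close>

lemma op_mult_apply: "f \<in> laurent_ring D \<Longrightarrow> op_mult D A B f = A (B f)"
  by (simp add: op_mult_def compose_def)

lemma op_one_apply: "f \<in> laurent_ring D \<Longrightarrow> op_one D f = f"
  by (simp add: op_one_def)

lemma op_scale_apply: "f \<in> laurent_ring D \<Longrightarrow> op_scale D c A f = smult_laurent c (A f)"
  by (simp add: op_scale_def)

lemma op_extensional: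
  "op_mult D A B \<in> extensional (laurent_ring D)" "op_one D \<in> extensional (laurent_ring D)"
  "op_scale D c A \<in> extensional (laurent_ring D)" "op_X D b \<in> extensional (laurent_ring D)"
  "op_T D i \<in> extensional (laurent_ring D)" "op_pi D m \<in> extensional (laurent_ring D)"
  by (simp_all add: op_mult_def compose_def op_one_def op_scale_def op_X_def op_T_def op_pi_def
      del: restrict_apply)

text \<open>What computing with words rests on: extensionality reduces equality of operators to
  values on the ring, invariance of the ring makes the restricted composition associative, and
  homogeneity lets monomial factors pass through an operator.\<close>

definition homogeneous_oper :: "root_sys \<Rightarrow> oper \<Rightarrow> bool"
  where "homogeneous_oper D A \<longleftrightarrow>
    A \<in> extensional (laurent_ring D) \<and> A ` laurent_ring D \<subseteq> laurent_ring D \<and>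
    (\<forall>c. \<forall>f\<in>laurent_ring D. A (smult_laurent c f) = smult_laurent c (A f))"

lemma homogeneous_operD:
  assumes "homogeneous_oper D A"
  shows "A \<in> extensional (laurent_ring D)" "f \<in> laurent_ring D \<Longrightarrow> A f \<in> laurent_ring D"
    "f \<in> laurent_ring D \<Longrightarrow> A (smult_laurent c f) = smult_laurent c (A f)"
  using assms by (auto simp: homogeneous_oper_def)

lemma laurent_ring_iff:
  "f \<in> laurent_ring D \<longleftrightarrow> (\<forall>b. Poly_Mapping.lookup f b \<noteq> 0 \<longrightarrow> b \<in> weight_lattice D)"
  by (auto simp: laurent_ring_def in_keys_iff)

lemma laurent_ring_smult: "f \<in> laurent_ring D \<Longrightarrow> smult_laurent c f \<in> laurent_ring D"
  unfolding laurent_ring_iff lookup_smult_laurent by (metis mult_zero_right)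

lemma laurent_ring_add: "f \<in> laurent_ring D \<Longrightarrow> g \<in> laurent_ring D \<Longrightarrow> f + g \<in> laurent_ring D"
  unfolding laurent_ring_iff lookup_add by (metis add_0)

lemma laurent_ring_diff: "f \<in> laurent_ring D \<Longrightarrow> g \<in> laurent_ring D \<Longrightarrow> f - g \<in> laurent_ring D"
  unfolding laurent_ring_iff lookup_minus by (metis diff_0_right)

lemma laurent_ring_sum: "(\<And>x. x \<in> A \<Longrightarrow> f x \<in> laurent_ring D) \<Longrightarrow> (\<Sum>x\<in>A. f x) \<in> laurent_ring D"
  by (induction A rule: infinite_finite_induct) (simp_all add: laurent_ring_add, simp_all add: laurent_ring_iff)

lemma laurent_ring_X_monom: "b \<in> weight_lattice D \<Longrightarrow> X_monom b \<in> laurent_ring D"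
  by (auto simp: laurent_ring_iff lookup_X_monom)

lemma laurent_ring_lin_ext:
  assumes "f \<in> laurent_ring D" "\<And>b. b \<in> weight_lattice D \<Longrightarrow> \<phi> b \<in> laurent_ring D"
  shows "lin_ext \<phi> f \<in> laurent_ring D"
  unfolding lin_ext_def using assms
  by (intro laurent_ring_sum laurent_ring_smult) (auto simp: laurent_ring_def)

lemma homogeneous_op_mult:
  "homogeneous_oper D A \<Longrightarrow> homogeneous_oper D B \<Longrightarrow> homogeneous_oper D (op_mult D A B)"
  by (auto simp: homogeneous_oper_def op_extensional op_mult_apply laurent_ring_smult image_subset_iff)

lemma homogeneous_op_one: "homogeneous_oper D (op_one D)"
  by (auto simp: homogeneous_oper_def op_extensional op_one_apply laurent_ring_smult)

lemma homogeneous_op_prod: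
  "(\<And>A. A \<in> set As \<Longrightarrow> homogeneous_oper D A) \<Longrightarrow> homogeneous_oper D (op_prod D As)"
  unfolding op_prod_def by (induction As) (simp_all add: homogeneous_op_mult homogeneous_op_one)

lemma op_prod_Nil [simp]: "op_prod D [] = op_one D"
  by (simp add: op_prod_def)

lemma op_prod_Cons [simp]: "op_prod D (A # As) = op_mult D A (op_prod D As)"
  by (simp add: op_prod_def)

lemma op_mult_assoc:
  "homogeneous_oper D C \<Longrightarrow> op_mult D (op_mult D A B) C = op_mult D A (op_mult D B C)"
  by (rule extensionalityI[OF op_extensional(1) op_extensional(1)])
    (simp add: op_mult_apply homogeneous_operD)

lemma op_mult_one_left: "homogeneous_oper D A \<Longrightarrow> op_mult D (op_one D) A = A"
  by (rule extensionalityI[OF op_extensional(1) homogeneous_operD(1)])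
    (simp_all add: op_mult_apply op_one_apply homogeneous_operD)

lemma op_mult_one_right: "homogeneous_oper D A \<Longrightarrow> op_mult D A (op_one D) = A"
  by (rule extensionalityI[OF op_extensional(1) homogeneous_operD(1)])
    (simp_all add: op_mult_apply op_one_apply)

lemma op_scale_mult:
  assumes "homogeneous_oper D A" "homogeneous_oper D B"
  shows "op_mult D (op_scale D c A) (op_scale D d B) = op_scale D (c * d) (op_mult D A B)"
  by (rule extensionalityI[OF op_extensional(1) op_extensional(3)])
    (simp add: op_mult_apply op_scale_apply homogeneous_operD[OF assms(1)] homogeneous_operD[OF assms(2)]
      laurent_ring_smult smult_laurent_simps)

lemma op_scale_scale: "op_scale D c (op_scale D d A) = op_scale D (c * d) A"
  by (rule extensionalityI[OF op_extensional(3) op_extensional(3)])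
    (simp add: op_scale_apply smult_laurent_simps)

lemma op_scale_one: "homogeneous_oper D A \<Longrightarrow> op_scale D 1 A = A"
  by (rule extensionalityI[OF op_extensional(3) homogeneous_operD(1)])
    (simp_all add: op_scale_apply smult_laurent_simps)

context root_datum
begin

lemma laurent_ring_one: "1 \<in> laurent_ring D"
  using laurent_ring_X_monom[OF weight_lattice_zero] by (simp add: X_monom_zero)

lemma laurent_ring_X_monom_mult:
  assumes "b \<in> weight_lattice D" "f \<in> laurent_ring D"
  shows "X_monom b * f \<in> laurent_ring D"
  unfolding laurent_ring_iff lookup_X_monom_mult
proof (intro allI impI)
  fix c assume "Poly_Mapping.lookup f (c - b) \<noteq> 0"
  with assms have "(c - b) + b \<in> weight_lattice D"
    by (intro weight_lattice_add) (auto simp: laurent_ring_iff)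
  then show "c \<in> weight_lattice D" by simp
qed

text \<open>The quotient g is the geometric sum of the X_{b + k a} over k < n, built term by
  term.\<close>

lemma X_monom_diff_dvd_nat:
  assumes "a \<in> weight_lattice D" "b \<in> weight_lattice D"
  shows "\<exists>g\<in>laurent_ring D. (X_monom a - 1) * g = X_monom (b + real n *\<^sub>v a) - X_monom b"
proof (induction n)
  case 0
  have "b + real 0 *\<^sub>v a = b" by (auto simp: vec_simps)
  then show ?case by (intro bexI[of _ 0]) (simp_all add: laurent_ring_iff)
next
  case (Suc n)
  then obtain g where g: "g \<in> laurent_ring D"
    "(X_monom a - 1) * g = X_monom (b + real n *\<^sub>v a) - X_monom b" by blast
  have "a + (b + real n *\<^sub>v a) = b + real (Suc n) *\<^sub>v a" by (auto simp: vec_simps algebra_simps)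
  then have "(X_monom a - 1) * X_monom (b + real n *\<^sub>v a)
      = X_monom (b + real (Suc n) *\<^sub>v a) - X_monom (b + real n *\<^sub>v a)"
    by (simp only: left_diff_distrib X_monom_mult mult_1)
  then have "(X_monom a - 1) * (X_monom (b + real n *\<^sub>v a) + g)
      = X_monom (b + real (Suc n) *\<^sub>v a) - X_monom b"
    by (simp only: distrib_left g(2)) simp
  moreover have "X_monom (b + real n *\<^sub>v a) + g \<in> laurent_ring D"
    using assms g by (intro laurent_ring_add laurent_ring_X_monom weight_lattice_add weight_lattice_smult)
      simp_all
  ultimately show ?case by blast
qed

text \<open>The weights b and s_i(b) lie on one string in direction \<alpha>_i. If the pairing is
  nonnegative, the string runs upwards from s_i(b) to b, and the quotient receives a minus
  sign.\<close>

lemma X_monom_refl_diff_dvd: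
  assumes "i \<in> {1..rnk D}" "b \<in> weight_lattice D"
  shows "\<exists>g\<in>laurent_ring D.
    (X_monom (sroot D i) - 1) * g = X_monom (refl_vec D (sroot D i) b) - X_monom b"
proof -
  let ?a = "sroot D i"
  obtain k where k: "copair D b ?a = of_int k"
    using copair_weight_Ints[OF assms(2,1)] by (auto elim: Ints_cases)
  show ?thesis
  proof (cases "k \<ge> 0")
    case True
    let ?b = "refl_vec D ?a b"
    have "?b + real (nat k) *\<^sub>v ?a = b" using True by (simp add: refl_vec_def k)
    then obtain g where "g \<in> laurent_ring D" "(X_monom ?a - 1) * g = X_monom b - X_monom ?b"
      using X_monom_diff_dvd_nat[OF sroot_weight_lattice[OF assms(1)] refl_weight_lattice[OF assms(2,1)], of "nat k"]
      by auto
    then show ?thesis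
      by (intro bexI[of _ "0 - g"]) (auto simp: laurent_ring_iff)
  next
    case False
    then have "b + real (nat (- k)) *\<^sub>v ?a = refl_vec D ?a b" by (simp add: refl_vec_def k vec_simps)
    then show ?thesis
      using X_monom_diff_dvd_nat[OF sroot_weight_lattice[OF assms(1)] assms(2), of "nat (- k)"] by simp
  qed
qed

lemma refl_diff_dvd:
  assumes i: "i \<in> {1..rnk D}" and f: "f \<in> laurent_ring D"
  shows "\<exists>g\<in>laurent_ring D. (X_monom (sroot D i) - 1) * g = weyl_act (refl_vec D (sroot D i)) f - f"
proof -
  let ?a = "sroot D i"
  obtain g where g: "\<And>b. b \<in> weight_lattice D \<Longrightarrow> g b \<in> laurent_ring D \<and>
      (X_monom ?a - 1) * g b = X_monom (refl_vec D ?a b) - X_monom b"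
    using X_monom_refl_diff_dvd[OF i] by metis
  have keys: "b \<in> weight_lattice D" if "b \<in> Poly_Mapping.keys f" for b
    using f that by (auto simp: laurent_ring_def)
  let ?G = "\<Sum>b\<in>Poly_Mapping.keys f. smult_laurent (Poly_Mapping.lookup f b) (g b)"
  have "(X_monom ?a - 1) * ?G = (\<Sum>b\<in>Poly_Mapping.keys f.
      smult_laurent (Poly_Mapping.lookup f b) (X_monom (refl_vec D ?a b) - X_monom b))"
    unfolding sum_distrib_left mult_smult_laurent using g keys by (intro sum.cong) simp_all
  also have "\<dots> = weyl_act (refl_vec D ?a) f - f"
    by (subst (5) laurent_eq_sum) (simp add: weyl_act_def lin_ext_def smult_laurent_simps sum_subtractf)
  finally show ?thesis
    using g keys by (intro bexI[of _ ?G] laurent_ring_sum laurent_ring_smult) auto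
qed

lemma quot_X_unique:
  assumes "i \<in> {1..rnk D}" "g \<in> laurent_ring D" "(X_monom (sroot D i) - 1) * g = f"
  shows "quot_X D (sroot D i) f = g"
  unfolding quot_X_def
proof (rule the_equality)
  fix h assume "h \<in> laurent_ring D \<and> (X_monom (sroot D i) - 1) * h = f"
  then have "(X_monom (sroot D i) - 1) * (h - g) = 0" using assms(3) by (simp add: right_diff_distrib)
  then show "h = g"
    using X_monom_minus_one_mult_eq_0 root_nonzero[OF sroot_root[OF assms(1)]] by fastforce
qed (use assms in simp)

lemma op_T_apply:
  assumes "i \<in> {1..rnk D}" "f \<in> laurent_ring D" "g \<in> laurent_ring D"
    "(X_monom (sroot D i) - 1) * g = weyl_act (refl_vec D (sroot D i)) f - f"
  shows "op_T D i f = smult_laurent (t_pow (nu D (sroot D i)) (1/2)) (weyl_act (refl_vec D (sroot D i)) f)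
    + smult_laurent (t_pow (nu D (sroot D i)) (1/2) - t_pow (nu D (sroot D i)) (-1/2)) g"
  using assms(2) quot_X_unique[OF assms(1,3,4)] by (simp add: op_T_def Let_def)

lemma homogeneous_op_T:
  assumes i: "i \<in> {1..rnk D}"
  shows "homogeneous_oper D (op_T D i)"
  unfolding homogeneous_oper_def
proof (intro conjI op_extensional allI ballI image_subsetI)
  fix f c assume f: "f \<in> laurent_ring D"
  let ?s = "weyl_act (refl_vec D (sroot D i))"
  obtain g where g: "g \<in> laurent_ring D" "(X_monom (sroot D i) - 1) * g = ?s f - f"
    using refl_diff_dvd[OF i f] by auto
  have s: "?s f \<in> laurent_ring D"
    unfolding weyl_act_def using f i
    by (intro laurent_ring_lin_ext laurent_ring_X_monom refl_weight_lattice)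
  show "op_T D i f \<in> laurent_ring D"
    unfolding op_T_apply[OF i f g] by (intro laurent_ring_add laurent_ring_smult s g)
  have sc: "?s (smult_laurent c f) = smult_laurent c (?s f)" by (simp add: weyl_act_def lin_ext_smult)
  then have "(X_monom (sroot D i) - 1) * smult_laurent c g = ?s (smult_laurent c f) - smult_laurent c f"
    by (simp add: mult_smult_laurent g smult_laurent_simps)
  from op_T_apply[OF i laurent_ring_smult[OF f] laurent_ring_smult[OF g(1)] this]
  show "op_T D i (smult_laurent c f) = smult_laurent c (op_T D i f)"
    unfolding op_T_apply[OF i f g] sc
    by (simp only: smult_laurent_simps(1,4) mult.commute[of c])
qed

text \<open>Here s_i(b) = b - \<alpha>_i, so the quotient of X_{s_i(b)} - X_b by X_{\<alpha>_i} - 1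
  is -X_{s_i(b)}, and the two terms of T_i combine to t_i^(1/2) - (t_i^(1/2) - t_i^(-1/2)) =
  t_i^(-1/2).\<close>

lemma op_T_X_monom:
  assumes i: "i \<in> {1..rnk D}" and b: "b \<in> weight_lattice D" and "copair D b (sroot D i) = 1"
  shows "op_T D i (X_monom b) =
    smult_laurent (t_pow (nu D (sroot D i)) (-1/2)) (X_monom (refl_vec D (sroot D i) b))"
proof -
  let ?a = "sroot D i"
  let ?b = "refl_vec D ?a b"
  have s: "weyl_act (refl_vec D ?a) (X_monom b) = X_monom ?b"
    by (simp add: weyl_act_def lin_ext_X_monom)
  have "?a + ?b = b" by (simp add: refl_vec_def assms(3) vec_simps)
  then have "(X_monom ?a - 1) * (0 - X_monom ?b) = weyl_act (refl_vec D ?a) (X_monom b) - X_monom b"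
    unfolding s by (simp add: left_diff_distrib X_monom_mult)
  moreover have "0 - X_monom ?b \<in> laurent_ring D"
    by (intro laurent_ring_diff laurent_ring_X_monom refl_weight_lattice i b) (simp add: laurent_ring_iff)
  ultimately show ?thesis
    by (simp add: op_T_apply[OF i laurent_ring_X_monom[OF b]] s smult_laurent_simps)
qed

lemma homogeneous_op_X: "b \<in> weight_lattice D \<Longrightarrow> homogeneous_oper D (op_X D b)"
  by (auto simp: homogeneous_oper_def op_extensional op_X_def laurent_ring_smult mult_smult_laurent
      laurent_ring_X_monom_mult)

lemma homogeneous_op_pi: "homogeneous_oper D (op_pi D m)"
proof -
  obtain js where js: "set js \<subseteq> {1..rnk D}" "u_elt D m = weyl_word D js"
    using u_elt_in_weyl by (auto simp: weyl_def)
  have "op_pi D m f \<in> laurent_ring D" if "f \<in> laurent_ring D" for f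
    using that js
    by (auto simp: op_pi_def inv_weyl_word
        intro!: laurent_ring_lin_ext laurent_ring_smult laurent_ring_X_monom weyl_word_weight_lattice)
  then show ?thesis
    by (auto simp: homogeneous_oper_def op_extensional op_pi_def laurent_ring_smult lin_ext_smult)
qed

lemma reduced_word_Eps:
  assumes "w \<in> weyl D" shows "reduced_word D w (SOME is. reduced_word D w is)"
  by (rule someI_ex) (use weyl_lengthE[OF assms] in \<open>auto simp: reduced_word_def\<close>)

lemma homogeneous_op_Tw:
  assumes "w \<in> weyl D" shows "homogeneous_oper D (op_Tw D w)"
  unfolding op_Tw_def using reduced_word_Eps[OF assms] unfolding reduced_word_def[of D w "Eps _"]
  by (intro homogeneous_op_prod) (force intro!: homogeneous_op_T)

lemma homogeneous_op_Ym: "homogeneous_oper D (op_Ym D m)"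
  unfolding op_Ym_def by (intro homogeneous_op_mult homogeneous_op_pi homogeneous_op_Tw u_elt_in_weyl)

lemma op_prod_daha: "(\<And>A. A \<in> set As \<Longrightarrow> A \<in> daha D) \<Longrightarrow> op_prod D As \<in> daha D"
  by (induction As) (simp_all add: daha_one daha_mult)

lemma op_Tw_daha:
  assumes "w \<in> weyl D" shows "op_Tw D w \<in> daha D"
  unfolding op_Tw_def using reduced_word_Eps[OF assms] unfolding reduced_word_def[of D w "Eps _"]
  by (intro op_prod_daha) (force intro!: daha_T)

text \<open>The identity already maps 0 to w_0(0) = 0, so minimality of length forces u_m = 1; the
  power of q in \<pi>_m has exponent 0.\<close>

lemma op_Ym_eq_one:
  assumes "fweight D m = 0"
  shows "op_Ym D m = op_one D"
proof -
  have zero: "w 0 = 0" if "w \<in> weyl D" for w using that by (auto simp: weyl_def weyl_word_linear)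
  have "weyl_length D (u_elt D m) \<le> weyl_length D id"
    using zero[OF longest_in_weyl] by (intro u_elt_minimal id_in_weyl) (simp only: assms id_apply)
  moreover have id: "weyl_length D id = 0" using weyl_length_le[of "[]" D] by simp
  ultimately have "weyl_length D (u_elt D m) = 0" by simp
  then have u: "u_elt D m = id" using weyl_lengthE[OF u_elt_in_weyl[of m]] by (metis length_0_conv weyl_word_Nil)
  have "(SOME is. reduced_word D id is) = []"
    using reduced_word_Eps[OF id_in_weyl] id by (simp add: reduced_word_def)
  then have T: "op_Tw D (u_elt D m) = op_one D" by (simp add: op_Tw_def u)
  have "op_pi D m = op_one D"
  proof (rule extensionalityI[OF op_extensional(6) op_extensional(2)])
    fix f assume f: "f \<in> laurent_ring D"
    have q: "q_pow 0 = 1" by (simp add: q_pow_def qt_monom_zero flip: zero_prod_def)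
    have "- ip D (longest D (fweight D m)) b = 0" for b
      by (simp only: assms zero[OF longest_in_weyl] ip_zero_left minus_zero)
    then have "op_pi D m f = lin_ext X_monom f"
      using f by (simp add: op_pi_def u q smult_laurent_simps)
    also have "\<dots> = f" by (simp add: lin_ext_def flip: laurent_eq_sum)
    finally show "op_pi D m f = op_one D f" using f by (simp add: op_one_apply)
  qed
  then show ?thesis by (simp add: op_Ym_def T op_mult_one_left homogeneous_op_one)
qed

end

section \<open>The operators attached to a minuscule weight\<close>

lemma superpolynomial_cong:
  assumes "\<And>N. N \<ge> m \<Longrightarrow> hat (J N) = hat (J' N)"
  shows "superpolynomial m J = superpolynomial m J'"
proof -
  have "(\<forall>N\<ge>m. hat (J N) = Some (h N)) \<longleftrightarrow> (\<forall>N\<ge>m. hat (J' N) = Some (h N))" for h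
    using assms by auto
  then show ?thesis unfolding superpolynomial_def by simp
qed

text \<open>A simulation principle: P relates operators to words and is kept by corresponding maps.
  The recursion of \<open>gamma_hat\<close> exchanges its two maps, so the induction generalizes
  over all four.\<close>

lemma gamma_hat_induct:
  assumes "\<And>A w. P A w \<Longrightarrow> P (\<tau>p A) (\<sigma>p w)" "\<And>A w. P A w \<Longrightarrow> P (\<tau>m A) (\<sigma>m w)" "P A w"
  shows "P (gamma_hat \<tau>p \<tau>m l A) (gamma_hat \<sigma>p \<sigma>m l w)"
  using assms
proof (induction l arbitrary: \<tau>p \<tau>m \<sigma>p \<sigma>m)
  case (Cons a l)
  have "P (gamma_hat \<tau>m \<tau>p l A) (gamma_hat \<sigma>m \<sigma>p l w)"
    by (rule Cons.IH) (use Cons.prems in auto)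
  then have "P ((\<tau>p ^^ n) (gamma_hat \<tau>m \<tau>p l A)) ((\<sigma>p ^^ n) (gamma_hat \<sigma>m \<sigma>p l w))" for n
    by (induction n) (simp_all add: Cons.prems(1))
  then show ?case by simp
qed simp

section \<open>Words in X and Y as operators\<close>

definition letter_oper :: "root_sys \<Rightarrow> nat \<Rightarrow> letter \<Rightarrow> oper"
  where "letter_oper D m x = (case x of LX \<Rightarrow> op_Xm D m | LY \<Rightarrow> op_Ym D m)"

lemma letter_oper_simps [simp]: "letter_oper D m LX = op_Xm D m" "letter_oper D m LY = op_Ym D m"
  by (simp_all add: letter_oper_def)

lemma word_oper_simps [simp]:
  "word_oper D m [] = op_one D"
  "word_oper D m (x # w) = op_mult D (letter_oper D m x) (word_oper D m w)"
  by (simp_all add: word_oper_def letter_oper_def)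

context minuscule_datum
begin

lemma homogeneous_letter_oper: "homogeneous_oper D (letter_oper D m x)"
  using m_range
  by (cases x) (simp_all add: op_Xm_def homogeneous_op_X fweight_weight_lattice homogeneous_op_Ym)

lemma homogeneous_word_oper: "homogeneous_oper D (word_oper D m w)"
  by (induction w) (simp_all add: homogeneous_op_one homogeneous_op_mult homogeneous_letter_oper)

lemma word_oper_append: "word_oper D m (v @ w) = op_mult D (word_oper D m v) (word_oper D m w)"
  by (induction v)
    (simp_all add: op_mult_one_left homogeneous_word_oper op_mult_assoc)

lemma letter_oper_daha: "letter_oper D m x \<in> daha D"
  using m_range minuscule
  by (cases x) (auto simp: op_Xm_def op_Ym_def u_elt_in_weyl
      intro!: daha_X daha_mult daha_pi op_Tw_daha fweight_weight_lattice)

text \<open>Needed because a \<open>daha_automorphism\<close> is required to respect products and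
  scalars only on \<open>daha D\<close>.\<close>

lemma word_oper_daha: "word_oper D m w \<in> daha D"
  by (induction w) (simp_all add: daha_one daha_mult letter_oper_daha)

text \<open>The simulation relation for \<open>gamma_hat_induct\<close>. The monomial is left
  unspecified because the hat-normalization removes it; it collects the powers of q produced by
  \<tau>_+ and \<tau>_-.\<close>

definition is_word_multiple :: "oper \<Rightarrow> letter list \<Rightarrow> bool"
  where "is_word_multiple A w \<longleftrightarrow> (\<exists>c. is_qt_monom c \<and> A = op_scale D c (word_oper D m w))"

lemma is_word_multiple_op_mult:
  assumes "is_word_multiple A v" "is_word_multiple B w"
  shows "is_word_multiple (op_mult D A B) (v @ w)"
proof -
  obtain c d where "is_qt_monom c" "A = op_scale D c (word_oper D m v)"
    "is_qt_monom d" "B = op_scale D d (word_oper D m w)"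
    using assms unfolding is_word_multiple_def by blast
  moreover from this have "op_mult D A B = op_scale D (c * d) (word_oper D m (v @ w))"
    by (simp add: op_scale_mult homogeneous_word_oper word_oper_append)
  ultimately show ?thesis unfolding is_word_multiple_def by blast
qed

lemma is_word_multiple_op_scale:
  assumes "is_word_multiple A w" "is_qt_monom c"
  shows "is_word_multiple (op_scale D c A) w"
  using assms unfolding is_word_multiple_def by (metis op_scale_scale is_qt_monom_intros(6))

lemma is_word_multiple_word_oper: "is_word_multiple (word_oper D m w) w"
  unfolding is_word_multiple_def
  by (intro exI[of _ 1]) (simp add: op_scale_one homogeneous_word_oper)

lemma is_word_multiple_letter_oper: "is_word_multiple (letter_oper D m x) [x]"
  using is_word_multiple_word_oper[of "[x]"] by (simp add: op_mult_one_right homogeneous_letter_oper)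

lemma is_word_multiple_automorphism:
  assumes \<tau>: "daha_automorphism D \<tau>"
    and letters: "\<And>x. is_word_multiple (\<tau> (letter_oper D m x)) (\<sigma> x)"
    and A: "is_word_multiple A w"
  shows "is_word_multiple (\<tau> A) (subst_word \<sigma> w)"
proof -
  have "is_word_multiple (\<tau> (word_oper D m w)) (subst_word \<sigma> w)" for w
  proof (induction w)
    case Nil
    then show ?case
      using \<tau> is_word_multiple_word_oper[of "[]"] by (simp add: daha_automorphism_def)
  next
    case (Cons x w)
    have "\<tau> (word_oper D m (x # w)) = op_mult D (\<tau> (letter_oper D m x)) (\<tau> (word_oper D m w))"
      using \<tau> by (simp add: daha_automorphism_def letter_oper_daha word_oper_daha)
    then show ?case using is_word_multiple_op_mult[OF letters Cons] by simp
  qed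
  moreover obtain c where "is_qt_monom c" "A = op_scale D c (word_oper D m w)"
    using A by (auto simp: is_word_multiple_def)
  moreover have "\<tau> (op_scale D c (word_oper D m w)) = op_scale D c (\<tau> (word_oper D m w))"
    using \<tau> by (simp add: daha_automorphism_def word_oper_daha)
  ultimately show ?thesis by (simp add: is_word_multiple_op_scale)
qed

lemma is_word_multiple_tau_plus:
  assumes "is_tau_plus D \<tau>" "is_word_multiple A w"
  shows "is_word_multiple (\<tau> A) (subst_word sub_plus_letter w)"
proof (rule is_word_multiple_automorphism[OF _ _ assms(2)])
  show "daha_automorphism D \<tau>" using assms(1) by (simp add: is_tau_plus_def)
  have XY: "is_word_multiple (op_mult D (op_Xm D m) (op_Ym D m)) [LX, LY]"
    using is_word_multiple_op_mult[OF is_word_multiple_letter_oper[of LX] is_word_multiple_letter_oper[of LY]]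
    by simp
  show "is_word_multiple (\<tau> (letter_oper D m x)) (sub_plus_letter x)" for x
    using assms(1) m_range minuscule XY is_word_multiple_letter_oper[of LX]
    by (cases x) (auto simp: is_tau_plus_def intro!: is_word_multiple_op_scale)
qed

lemma is_word_multiple_tau_minus:
  assumes "is_tau_minus D \<tau>" "is_word_multiple A w"
  shows "is_word_multiple (\<tau> A) (subst_word sub_minus_letter w)"
proof (rule is_word_multiple_automorphism[OF _ _ assms(2)])
  show "daha_automorphism D \<tau>" using assms(1) by (simp add: is_tau_minus_def)
  have YX: "is_word_multiple (op_mult D (op_Ym D m) (op_Xm D m)) [LY, LX]"
    using is_word_multiple_op_mult[OF is_word_multiple_letter_oper[of LY] is_word_multiple_letter_oper[of LX]]
    by simp
  show "is_word_multiple (\<tau> (letter_oper D m x)) (sub_minus_letter x)" for x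
    using assms(1) m_range minuscule YX is_word_multiple_letter_oper[of LY]
    by (cases x) (auto simp: is_tau_minus_def intro!: is_word_multiple_op_scale)
qed

lemma is_word_multiple_gamma_hat:
  assumes "is_tau_plus D \<tau>p" "is_tau_minus D \<tau>m"
  shows "is_word_multiple (gamma_hat \<tau>p \<tau>m l (op_Xm D m)) (torus_word l)"
  unfolding torus_word_def
  using is_word_multiple_tau_plus[OF assms(1)] is_word_multiple_tau_minus[OF assms(2)]
    is_word_multiple_letter_oper[of LX]
  by (intro gamma_hat_induct[of is_word_multiple]) simp_all

text \<open>Induction over the suffixes \<open>js\<close> of one fixed minimal word: minimality is a
  property of the whole word \<open>is\<close>, and \<open>copair_minimal_word\<close> turns it into
  pairing 1 at each letter, as \<open>op_T_X_monom\<close> demands.\<close>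

lemma op_T_word_X_monom:
  assumes "set is \<subseteq> {1..rnk D}" "is = ks @ js"
    and minimal: "\<And>is'. set is' \<subseteq> {1..rnk D} \<Longrightarrow>
      weyl_word D is' (fweight D m) = weyl_word D is (fweight D m) \<Longrightarrow> length is \<le> length is'"
  shows "\<exists>c. is_qt_monom c \<and> op_prod D (map (op_T D) js) (X_monom (fweight D m)) =
    smult_laurent c (X_monom (weyl_word D js (fweight D m)))"
  using assms(2)
proof (induction js arbitrary: ks)
  case Nil
  have "op_one D (X_monom (fweight D m)) = smult_laurent 1 (X_monom (fweight D m))"
    using m_range by (simp add: op_one_apply laurent_ring_X_monom fweight_weight_lattice smult_laurent_simps)
  then show ?case by (auto intro!: exI[of _ 1])
next
  case (Cons i js)
  then obtain c where c: "is_qt_monom c" "op_prod D (map (op_T D) js) (X_monom (fweight D m)) =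
      smult_laurent c (X_monom (weyl_word D js (fweight D m)))" by (metis append_Cons append_Nil append_assoc)
  let ?b = "weyl_word D js (fweight D m)"
  have X: "X_monom (fweight D m) \<in> laurent_ring D"
    using m_range by (intro laurent_ring_X_monom fweight_weight_lattice)
  have i: "i \<in> {1..rnk D}" and js: "set js \<subseteq> {1..rnk D}" using assms(1) Cons.prems by auto
  have b: "?b \<in> weight_lattice D" using js m_range by (intro weyl_word_weight_lattice fweight_weight_lattice)
  have "copair D ?b (sroot D i) = 1"
    using assms(1) minimal unfolding Cons.prems by (rule copair_minimal_word)
  note T = op_T_X_monom[OF i b this]
  have "op_prod D (map (op_T D) (i # js)) (X_monom (fweight D m))
      = op_T D i (smult_laurent c (X_monom ?b))"
    by (simp add: op_mult_apply X c)
  also have "\<dots> = smult_laurent c (op_T D i (X_monom ?b))"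
    by (rule homogeneous_operD(3)[OF homogeneous_op_T[OF i] laurent_ring_X_monom[OF b]])
  finally show ?case using c(1) unfolding T smult_laurent_simps by auto
qed

lemma op_Ym_X_monom:
  "\<exists>c. is_qt_monom c \<and> op_Ym D m (X_monom (fweight D m)) = smult_laurent c (X_monom (fweight D m))"
proof -
  define js where "js = (SOME is. reduced_word D (u_elt D m) is)"
  have js: "set js \<subseteq> {1..rnk D}" "weyl_word D js = u_elt D m" "length js = weyl_length D (u_elt D m)"
    using reduced_word_Eps[OF u_elt_in_weyl[of m]] by (simp_all add: js_def reduced_word_def[of D _ "Eps _"])
  let ?w = "fweight D m"
  have w: "?w \<in> weight_lattice D" using m_range by (rule fweight_weight_lattice)
  have uw: "u_elt D m ?w \<in> weight_lattice D" using js w by (metis weyl_word_weight_lattice)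
  have "\<exists>c. is_qt_monom c \<and> op_prod D (map (op_T D) js) (X_monom ?w) =
      smult_laurent c (X_monom (weyl_word D js ?w))"
  \<comment> \<open>More is required than reducedness of \<open>js\<close>: it must be shortest
    among all words taking \<omega>_m to the same weight. This is the minimality in the definition
    of u_m.\<close>
  proof (rule op_T_word_X_monom[OF js(1), of "[]"])
    fix ks assume ks: "set ks \<subseteq> {1..rnk D}" "weyl_word D ks ?w = weyl_word D js ?w"
    then have "weyl_length D (u_elt D m) \<le> weyl_length D (weyl_word D ks)"
      by (intro u_elt_minimal) (auto simp: weyl_def js u_elt_fweight)
    with weyl_length_le[OF ks(1)] js(3) show "length js \<le> length ks" by simp
  qed simp
  then obtain c where c: "is_qt_monom c" "op_Tw D (u_elt D m) (X_monom ?w) = smult_laurent c (X_monom (u_elt D m ?w))"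
    by (auto simp: op_Tw_def js simp flip: js_def)
  have "op_Ym D m (X_monom ?w) = op_pi D m (smult_laurent c (X_monom (u_elt D m ?w)))"
    by (simp add: op_Ym_def op_mult_apply laurent_ring_X_monom w c)
  also have "\<dots> = smult_laurent c (op_pi D m (X_monom (u_elt D m ?w)))"
    by (rule homogeneous_operD(3)[OF homogeneous_op_pi laurent_ring_X_monom[OF uw]])
  also have "op_pi D m (X_monom (u_elt D m ?w))
      = smult_laurent (q_pow (- ip D (longest D ?w) (u_elt D m ?w))) (X_monom (inv (u_elt D m) (u_elt D m ?w)))"
    using laurent_ring_X_monom[OF uw] by (simp add: op_pi_def lin_ext_X_monom)
  also have "inv (u_elt D m) (u_elt D m ?w) = ?w"
    using bij_weyl_word[OF js(1)] js(2) by (simp add: bij_is_inj)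
  finally show ?thesis using c(1) by (auto simp: smult_laurent_simps)
qed

lemma coinvariant_torus_word:
  "\<exists>c. is_qt_monom c \<and> coinvariant D (word_oper D m (replicate p LX @ v @ replicate z LY @ [LX]))
    = c * coinvariant D (op_mult D (word_oper D m v) (op_Xm D m))"
proof -
  let ?w = "fweight D m"
  have w: "?w \<in> weight_lattice D" using m_range by (rule fweight_weight_lattice)
  have X: "X_monom ?w \<in> laurent_ring D" by (rule laurent_ring_X_monom[OF w])
  have X1: "op_Xm D m 1 = X_monom ?w" by (simp add: op_Xm_def op_X_def laurent_ring_one)
  note L = laurent_ring_one X homogeneous_operD(2)[OF homogeneous_word_oper] laurent_ring_smult
    homogeneous_operD(2)[OF homogeneous_letter_oper]
  have "\<exists>c. is_qt_monom c \<and> word_oper D m (replicate z LY @ [LX]) 1 = smult_laurent c (X_monom ?w)"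
  proof (induction z)
    case 0
    have "word_oper D m [LX] 1 = smult_laurent 1 (X_monom ?w)"
      by (simp add: op_mult_apply op_one_apply L X1 smult_laurent_simps)
    then show ?case by (auto intro!: exI[of _ 1])
  next
    case (Suc z)
    then obtain c where c: "is_qt_monom c"
      "word_oper D m (replicate z LY @ [LX]) 1 = smult_laurent c (X_monom ?w)" by blast
    obtain d where d: "is_qt_monom d" "op_Ym D m (X_monom ?w) = smult_laurent d (X_monom ?w)"
      using op_Ym_X_monom by blast
    have "word_oper D m (replicate (Suc z) LY @ [LX]) 1 = op_Ym D m (smult_laurent c (X_monom ?w))"
      by (simp add: op_mult_apply L c)
    also have "\<dots> = smult_laurent (c * d) (X_monom ?w)"
      by (simp add: homogeneous_operD(3)[OF homogeneous_op_Ym X] d smult_laurent_simps)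
    finally show ?case using c d by auto
  qed
  then obtain c where c: "is_qt_monom c"
    "word_oper D m (replicate z LY @ [LX]) 1 = smult_laurent c (X_monom ?w)" by blast
  let ?f = "word_oper D m v (X_monom ?w)"
  have "word_oper D m (v @ replicate z LY @ [LX]) 1 = smult_laurent c ?f"
    unfolding word_oper_append[of v] op_mult_apply[OF laurent_ring_one] c
    by (rule homogeneous_operD(3)[OF homogeneous_word_oper X])
  moreover have "\<exists>d. is_qt_monom d \<and> eval_rho D (word_oper D m (replicate p LX) f) = d * eval_rho D f"
    if "f \<in> laurent_ring D" for f
  proof (induction p)
    case 0
    then show ?case using that by (auto simp: op_one_apply intro!: exI[of _ 1])
  next
    case (Suc p)
    then obtain d where d: "is_qt_monom d" "eval_rho D (word_oper D m (replicate p LX) f) = d * eval_rho D f"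
      by blast
    have "eval_rho D (word_oper D m (replicate (Suc p) LX) f) = (eval_X D ?w * d) * eval_rho D f"
      using that by (simp add: op_mult_apply op_Xm_def op_X_def L eval_rho_X_monom_mult d mult.assoc)
    then show ?case using d by auto
  qed
  then obtain d where "is_qt_monom d"
    "eval_rho D (word_oper D m (replicate p LX) (smult_laurent c ?f)) = d * eval_rho D (smult_laurent c ?f)"
    using L by meson
  ultimately have "coinvariant D (word_oper D m (replicate p LX @ v @ replicate z LY @ [LX]))
      = (d * c) * coinvariant D (op_mult D (word_oper D m v) (op_Xm D m))" "is_qt_monom (d * c)"
    using c by (simp_all add: coinvariant_def word_oper_append op_mult_apply L X1 eval_rho_smult mult.assoc
        del: append_assoc)
  then show ?thesis by blast
qed

lemma hat_diagram_J:
  assumes "r > 0" "s > 0" "coprime r s" "is_tau_plus D \<tau>p" "is_tau_minus D \<tau>m"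
  shows "hat (diagram_J D m (torus_diagram r s)) = hat (daha_jones D \<tau>p \<tau>m r s m)"
proof -
  let ?A = "gamma_hat \<tau>p \<tau>m (even_cf r s) (op_Xm D m)"
  obtain p z where w: "torus_word (even_cf r s) =
      replicate p LX @ diagram_word (torus_diagram r s) @ replicate z LY @ [LX]"
    using torus_word_even_cf[OF assms(1-3)] by blast
  obtain c where c: "is_qt_monom c" "?A = op_scale D c (word_oper D m (torus_word (even_cf r s)))"
    using is_word_multiple_gamma_hat[OF assms(4,5)] by (auto simp: is_word_multiple_def)
  obtain d where d: "is_qt_monom d" "coinvariant D (word_oper D m (torus_word (even_cf r s)))
      = d * diagram_J D m (torus_diagram r s)"
    using coinvariant_torus_word unfolding w diagram_J_def by blast
  have "coinvariant D ?A = c * coinvariant D (word_oper D m (torus_word (even_cf r s)))"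
    by (simp add: c coinvariant_def op_scale_apply laurent_ring_one eval_rho_smult)
  then have "daha_jones D \<tau>p \<tau>m r s m
      = (eval_X D (- fweight D m) * c * d) * diagram_J D m (torus_diagram r s)"
    by (simp add: daha_jones_def d ac_simps)
  then show ?thesis using hat_monom_mult c d by simp
qed

end

section \<open>Type A\<close>

lemma type_A_simps [simp]:
  "dimn (type_A N) = N" "rnk (type_A N) = N - 1"
  "sroot (type_A N) i = unit_vec (i - 1) - unit_vec i"
  by (simp_all add: type_A_def)

lemma type_A_rootE:
  assumes "a \<in> roots (type_A N)"
  obtains i j where "a = unit_vec i - unit_vec j" "i < N" "j < N" "i \<noteq> j"
  using assms by (auto simp: type_A_def)

lemma type_A_rootI: "i < N \<Longrightarrow> j < N \<Longrightarrow> i \<noteq> j \<Longrightarrow> unit_vec i - unit_vec j \<in> roots (type_A N)"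
  by (auto simp: type_A_def)

lemma unit_vec_apply: "unit_vec i j = (if j = i then 1 else 0)"
  by (simp add: unit_vec_def)

lemma ip_type_A_root:
  assumes "i < N" "j < N"
  shows "ip (type_A N) v (unit_vec i - unit_vec j) = v i - v j"
  using assms
  by (simp add: ip_def unit_vec_apply right_diff_distrib sum_subtractf if_distrib[of "\<lambda>x. _ * x"]
      sum.delta cong: if_cong)

lemma copair_type_A_root:
  assumes "i < N" "j < N" "i \<noteq> j"
  shows "copair (type_A N) v (unit_vec i - unit_vec j) = v i - v j"
  using assms by (simp add: copair_def ip_type_A_root unit_vec_apply)

lemma refl_vec_type_A_unit_vec:
  assumes "i < N" "j < N" "i \<noteq> j"
  shows "refl_vec (type_A N) (unit_vec i - unit_vec j) (unit_vec k) =
    unit_vec (if k = i then j else if k = j then i else k)"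
  using assms by (auto simp: refl_vec_def copair_type_A_root vec_simps unit_vec_apply)

lemma reduced_type_A: "reduced_root_system (type_A N)"
  unfolding reduced_root_system_def
proof (intro conjI ballI allI impI)
  have "roots (type_A N) \<subseteq> (\<lambda>(i, j). unit_vec i - unit_vec j) ` ({..<N} \<times> {..<N})"
    by (auto simp: type_A_def)
  then show "finite (roots (type_A N))" by (rule finite_subset) simp
  show zero: "0 \<notin> roots (type_A N)"
  proof
    assume "0 \<in> roots (type_A N)"
    then obtain i j where ij: "0 = unit_vec i - unit_vec j" "i \<noteq> j" by (rule type_A_rootE)
    from fun_cong[OF ij(1), of i] ij(2) show False by (simp add: unit_vec_apply)
  qed
  fix a assume a: "a \<in> roots (type_A N)"
  then obtain i j where ij: "a = unit_vec i - unit_vec j" "i < N" "j < N" "i \<noteq> j" by (rule type_A_rootE)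
  show "a k = 0" if "dimn (type_A N) \<le> k" for k using that ij by (simp add: unit_vec_apply)
  { fix b assume "b \<in> roots (type_A N)"
    then obtain k l where kl: "b = unit_vec k - unit_vec l" "k < N" "l < N" "k \<noteq> l" by (rule type_A_rootE)
    show "refl_vec (type_A N) a b \<in> roots (type_A N)"
      unfolding ij(1) kl(1) refl_vec_simps refl_vec_type_A_unit_vec[OF ij(2-4)]
      by (rule type_A_rootI) (use ij kl in auto)
    show "copair (type_A N) b a \<in> \<int>"
      unfolding ij(1) kl(1) copair_type_A_root[OF ij(2-4)] by (simp add: unit_vec_apply) }
  fix c assume c: "c *\<^sub>v a \<in> roots (type_A N)"
  then obtain k l where kl: "c *\<^sub>v a = unit_vec k - unit_vec l" by (rule type_A_rootE)
  have "c \<noteq> 0"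
  proof
    assume "c = 0"
    then have "c *\<^sub>v a = 0" by (simp add: vec_simps)
    with c zero show False by metis
  qed
  \<comment> \<open>The i-th coordinate of a is 1, so c itself is a coordinate of a root.\<close>
  moreover from fun_cong[OF kl, of i] have "c \<in> {-1, 0, 1}"
    using ij by (auto simp: smult_vec_apply unit_vec_apply split: if_splits)
  ultimately show "c = 1 \<or> c = -1" by auto
qed

text \<open>Coordinate j is the difference c (j + 1) - c j, where c counts as 0 at indices 0 and N
  and beyond. Coefficients are thus recovered from coordinates by partial sums.\<close>

lemma simple_root_sum_type_A:
  "(\<Sum>i=1..rnk (type_A N). c i *\<^sub>v sroot (type_A N) i) j =
    (if Suc j < N then c (Suc j) else 0) - (if j \<in> {1..<N} then c j else 0)"
proof -
  have "(\<Sum>i=1..N - 1. c i * (if j = i - 1 then 1 else 0)) = (\<Sum>i=1..N - 1. if i = Suc j then c i else 0)"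
    by (intro sum.cong) auto
  moreover have "(\<Sum>i=1..N - 1. c i * (if j = i then 1 else 0)) = (\<Sum>i=1..N - 1. if i = j then c i else 0)"
    by (intro sum.cong) auto
  ultimately have "(\<Sum>i=1..N - 1. c i * (if j = i - 1 then 1 else 0)) - (\<Sum>i=1..N - 1. c i * (if j = i then 1 else 0))
      = (if Suc j < N then c (Suc j) else 0) - (if j \<in> {1..<N} then c j else 0)"
    by (auto simp: sum.delta)
  then show ?thesis
    by (simp add: vec_simps unit_vec_apply right_diff_distrib sum_subtractf)
qed

lemma type_A_pos_rootI:
  assumes "i < j" "j < N"
  shows "unit_vec i - unit_vec j \<in> pos_roots (type_A N)"
proof -
  \<comment> \<open>For i < j, e_i - e_j is the sum of the simple roots with indices i + 1, ...,
    j.\<close>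
  let ?k = "\<lambda>x. if i < x \<and> x \<le> j then 1 else (0::nat)"
  have "unit_vec i - unit_vec j = (\<Sum>x=1..rnk (type_A N). real (?k x) *\<^sub>v sroot (type_A N) x)"
    using assms by (intro ext, subst simple_root_sum_type_A) (auto simp: unit_vec_apply)
  moreover have "unit_vec i - unit_vec j \<in> roots (type_A N)"
    using assms by (intro type_A_rootI) simp_all
  ultimately show ?thesis unfolding pos_roots_def by (intro CollectI conjI exI[of _ ?k])
qed

lemma simple_roots_type_A: "simple_roots_of (type_A N)"
  unfolding simple_roots_of_def
proof (intro conjI ballI allI impI)
  fix i assume "i \<in> {1..rnk (type_A N)}"
  then show "sroot (type_A N) i \<in> roots (type_A N)" by (auto intro!: type_A_rootI)
next
  fix c i assume sum: "(\<Sum>i=1..rnk (type_A N). c i *\<^sub>v sroot (type_A N) i) = 0"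
    and i: "i \<in> {1..rnk (type_A N)}"
  \<comment> \<open>Extension of c by zero: all its successive differences vanish, so it is
    constant, and it is 0 at index 0.\<close>
  define C where "C j = (if j \<in> {1..<N} then c j else 0)" for j
  have "C (Suc j) - C j = 0" for j
    using fun_cong[OF sum, of j] unfolding simple_root_sum_type_A C_def by simp
  then have "C j = 0" for j by (induction j) (simp_all add: C_def)
  from this[of i] i show "c i = 0" by (auto simp: C_def split: if_splits)
next
  fix a assume "a \<in> roots (type_A N)"
  then obtain i j where ij: "a = unit_vec i - unit_vec j" "i < N" "j < N" "i \<noteq> j" by (rule type_A_rootE)
  then show "a \<in> pos_roots (type_A N) \<or> - a \<in> pos_roots (type_A N)"
    using type_A_pos_rootI[of i j N] type_A_pos_rootI[of j i N] by (cases "i < j") simp_all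
qed

lemma fweight_type_A_apply:
  "fweight (type_A N) m j = (if j < m then 1 else 0) - (if j < N then real m / real N else 0)"
proof -
  have "(\<Sum>i<n. unit_vec i) j = (if j < n then 1 else 0)" for n
    by (simp add: vec_simps unit_vec_apply sum.delta)
  then show ?thesis by (simp add: type_A_def smult_vec_apply)
qed

lemma fundamental_weights_type_A: "fundamental_weights_of (type_A N)"
  unfolding fundamental_weights_of_def
proof (intro conjI ballI)
  fix i assume i: "i \<in> {1..rnk (type_A N)}"
  \<comment> \<open>Partial sums of the coordinates of the weight, which are its coefficients in the
    simple roots. The boundary condition at N holds because the coordinates add up to 0.\<close>
  define P where "P x = (\<Sum>j<x. fweight (type_A N) i j)" for x
  have N: "{..<N} \<inter> {j. j < i} = {..<i}" "N > 0" "i < N" using i by auto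
  then have "P N = 0"
    by (simp add: P_def fweight_type_A_apply sum_subtractf sum.If_cases)
  moreover have "fweight (type_A N) i j = 0" if "j \<ge> N" for j
    using that N by (simp add: fweight_type_A_apply)
  moreover have "P (Suc j) = P j + fweight (type_A N) i j" "P 0 = 0" for j by (simp_all add: P_def)
  ultimately have "fweight (type_A N) i j = (if Suc j < N then P (Suc j) else 0) - (if j \<in> {1..<N} then P j else 0)"
    for j by (cases "Suc j < N"; cases "Suc j = N"; cases "j = 0") fastforce+
  then have "fweight (type_A N) i = (\<Sum>x=1..rnk (type_A N). P x *\<^sub>v sroot (type_A N) x)"
    by (intro ext) (simp only: simple_root_sum_type_A)
  then show "fweight (type_A N) i \<in> simple_span (type_A N)" by (auto simp only: simple_span_def)
  fix j assume "j \<in> {1..rnk (type_A N)}"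
  then show "copair (type_A N) (fweight (type_A N) i) (sroot (type_A N) j) = (if i = j then 1 else 0)"
    by (auto simp: copair_type_A_root fweight_type_A_apply)
qed

interpretation type_A: root_datum "type_A N" for N
  by unfold_locales (rule reduced_type_A simple_roots_type_A fundamental_weights_type_A)+

text \<open>The lower bound comes from the nonnegative expansion of a in simple roots. The upper
  bound holds for every root: the terms m / N cancel and the coordinates of \<omega>_m differ by at
  most 1.\<close>

lemma minuscule_type_A:
  assumes "m \<in> {1..rnk (type_A N)}"
  shows "minuscule (type_A N) m"
  unfolding minuscule_def
proof
  fix a assume "a \<in> pos_roots (type_A N)"
  then obtain k :: "nat \<Rightarrow> nat" where root: "a \<in> roots (type_A N)"
    and k: "a = (\<Sum>i=1..rnk (type_A N). real (k i) *\<^sub>v sroot (type_A N) i)"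
    unfolding pos_roots_def by blast
  obtain i j where ij: "a = unit_vec i - unit_vec j" "i < N" "j < N" "i \<noteq> j"
    using root by (rule type_A_rootE)
  let ?w = "fweight (type_A N) m"
  \<comment> \<open>The inner product is linear in the root, as \<open>copair\<close> is not; on
    roots of type A they agree.\<close>
  have "ip (type_A N) ?w (sroot (type_A N) i) \<ge> 0" if "i \<in> {1..rnk (type_A N)}" for i
  proof -
    have "i - 1 < N" "i < N" "i - 1 \<noteq> i" using that by auto
    then have "ip (type_A N) ?w (sroot (type_A N) i) = copair (type_A N) ?w (sroot (type_A N) i)"
      by (simp add: ip_type_A_root copair_type_A_root)
    then show ?thesis using type_A.copair_fweight_sroot[OF assms that] by simp
  qed
  then have "ip (type_A N) ?w a \<ge> 0" by (simp only: k ip_right_simps) (intro sum_nonneg, simp)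
  then show "0 \<le> copair (type_A N) ?w a \<and> copair (type_A N) ?w a \<le> 1"
    using ij by (simp add: ip_type_A_root copair_type_A_root fweight_type_A_apply)
qed

text \<open>For \<open>type_A m\<close> the index m exceeds the rank, so the prescribed values of
  the automorphisms on letters do not cover it. But both letters are then the identity operator,
  which every automorphism fixes.\<close>

lemma hat_diagram_J_trivial_weight:
  assumes "root_datum D" "fweight D m = 0" "is_tau_plus D \<tau>p" "is_tau_minus D \<tau>m"
  shows "hat (diagram_J D m (torus_diagram r s)) = hat (daha_jones D \<tau>p \<tau>m r s m)"
proof -
  interpret root_datum D by fact
  note one = homogeneous_op_one op_mult_one_left
  have Y: "op_Ym D m = op_one D" using assms(2) by (rule op_Ym_eq_one)
  have X: "op_Xm D m = op_one D" by (simp add: op_Xm_def op_X_def op_one_def assms(2) X_monom_zero)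
  have "word_oper D m w = op_one D" for w
    by (induction w) (simp_all add: letter_oper_def X Y one split: letter.splits)
  then have J: "diagram_J D m l = coinvariant D (op_one D)" for l by (simp add: diagram_J_def X one)
  have \<tau>: "\<tau>p (op_one D) = op_one D" "\<tau>m (op_one D) = op_one D"
    using assms(3,4) by (simp_all add: is_tau_plus_def is_tau_minus_def daha_automorphism_def)
  have "gamma_hat \<tau>p \<tau>m l (op_one D) = op_one D" for l
    using gamma_hat_induct[of "\<lambda>A _. A = op_one D" \<tau>p id \<tau>m id "op_one D" undefined] \<tau> by simp
  moreover have "eval_X D (- fweight D m) = 1"
    unfolding assms(2) by (simp only: minus_zero eval_X_zero)
  ultimately show ?thesis by (simp add: J daha_jones_def X)
qed

theorem theorem3p4:
  fixes r s :: nat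
  assumes "r > 0" and "s > 0" and "coprime r s"
  shows
    "(\<forall>m\<ge>1. \<forall>\<tau>p \<tau>m.
        (\<forall>N\<ge>m. is_tau_plus (type_A N) (\<tau>p N) \<and> is_tau_minus (type_A N) (\<tau>m N)) \<longrightarrow>
        diagram_superpoly m (torus_diagram r s) = torus_superpoly \<tau>p \<tau>m r s m) \<and>
     (\<forall>D m \<tau>p \<tau>m.
        irreducible_root_system D \<and> m \<in> {1..rnk D} \<and> minuscule D m \<and>
        is_tau_plus D \<tau>p \<and> is_tau_minus D \<tau>m \<longrightarrow>
        hat (diagram_J D m (torus_diagram r s)) = hat (daha_jones D \<tau>p \<tau>m r s m))"
proof (intro conjI allI impI)
  fix m :: nat and \<tau>p \<tau>m
  assume m: "1 \<le> m"
    and \<tau>: "\<forall>N\<ge>m. is_tau_plus (type_A N) (\<tau>p N) \<and> is_tau_minus (type_A N) (\<tau>m N)"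
  show "diagram_superpoly m (torus_diagram r s) = torus_superpoly \<tau>p \<tau>m r s m"
    unfolding diagram_superpoly_def torus_superpoly_def
  proof (rule superpolynomial_cong)
    fix N assume N: "m \<le> N"
    show "hat (diagram_J (type_A N) m (torus_diagram r s)) = hat (daha_jones (type_A N) (\<tau>p N) (\<tau>m N) r s m)"
    proof (cases "m = N")
      case True
      have "fweight (type_A N) m = 0"
        using m by (simp add: True fun_eq_iff fweight_type_A_apply)
      then show ?thesis
        using \<tau> N by (intro hat_diagram_J_trivial_weight type_A.root_datum_axioms) simp_all
    next
      case False
      then have "m \<in> {1..rnk (type_A N)}" using m N by simp
      then interpret minuscule_datum "type_A N" m
        by unfold_locales (simp_all only: minuscule_type_A)
      show ?thesis using \<tau> N by (intro hat_diagram_J assms) simp_all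
    qed
  qed
next
  fix D m \<tau>p \<tau>m
  assume D: "irreducible_root_system D \<and> m \<in> {1..rnk D} \<and> minuscule D m \<and>
    is_tau_plus D \<tau>p \<and> is_tau_minus D \<tau>m"
  then interpret minuscule_datum D m
    by unfold_locales (simp_all add: irreducible_root_system_def)
  show "hat (diagram_J D m (torus_diagram r s)) = hat (daha_jones D \<tau>p \<tau>m r s m)"
    using D by (intro hat_diagram_J assms) simp_all
qed

end
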